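(* Let $N=2^m$. Let $G$ be a subgroup of the Clifford group $\mathrm{Cliff}_N$ containing all $D(a,b)\in HW_N$, and let $\mathcal{E}=\{\frac{1}{|G|},U\}_{U\in G}$ be the ensemble defined by the uniform distribution. If $G$ acts transitively on vertices of the Heisenberg-Weyl graph $\mathbb{H}_N$, then $\mathcal{E}$ is a unitary $2$-design, and if $G$ acts transitively on vertices, edges and non-edges of $\mathbb{H}_N$, then $\mathcal{E}$ is a unitary $3$-design.
   Context: With $X=\begin{bmatrix}0&1\\1&0\end{bmatrix}$, $Z=\begin{bmatrix}1&0\\0&-1\end{bmatrix}$ and row vectors $a,b\in\mathbb{F}_2^m$, $D(a,b)=X^{a_1}Z^{b_1}\otimes\cdots\otimes X^{a_m}Z^{b_m}$, an $N\times N$ unitary matrix. The Heisenberg-Weyl (Pauli) group is $HW_N=\{\imath^\kappa D(a,b):a,b\in\mathbb{F}_2^m,\ \kappa\in\mathbb{Z}_4\}$, $\imath=\sqrt{-1}$. The matrix $E(a,b)=\imath^{ab^T}D(a,b)$ is Hermitian. The Clifford group $\mathrm{Cliff}_N$ consists of all $N\times N$ unitary matrices $g$ with $gD(a,b)g^\dagger\in HW_N$ for all $D(a,b)\in HW_N$. The Heisenberg-Weyl graph $\mathbb{H}_N$ has $N^2-1$ vertices, labeled by pairs $\pm E(a,b)$ with $[a,b]\neq[0,0]$; (distinct) vertices labeled $\pm E(a,b)$ and $\pm E(c,d)$ are joined by an edge if $E(a,b)$ commutes with $E(c,d)$; pairs of distinct vertices that are not joined are non-edges. Elements of the Clifford group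 act by conjugation on $HW_N$, inducing automorphisms of $\mathbb{H}_N$. For a positive integer $k$, an ensemble $\mathcal{E}=\{p_i,U_i\}_{i=1}^n$, where the $N\times N$ unitary matrix $U_i$ is selected with probability $p_i$, is a unitary $k$-design if for all linear operators $\mathcal{X}$ on $(\mathbb{C}^N)^{\otimes k}$, $$\sum_{(p,U)\in\mathcal{E}} p\,U^{\otimes k}\mathcal{X}(U^\dagger)^{\otimes k}=\int_{\mathbb{U}_N}d\eta(U)\,U^{\otimes k}\mathcal{X}(U^\dagger)^{\otimes k},$$ where $\eta$ denotes the Haar measure on the unitary group $\mathbb{U}_N$.
   Formalization: If edges and non-edges are unordered pairs, the 3-design claim is proved only for m ≥ 2: at m = 1 it fails for the group generated by the Paulis and a Clifford cycling X, Y, Z. If they are ordered pairs, it is proved for every m ≥ 1. *)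

theory Defs
  imports "HOL-Probability.Probability" "HOL-Algebra.Group" "HOL-Library.Z2"
begin

instance bit :: finite
proof
  have "UNIV = {0, 1 :: bit}"
    using bit_not_one_iff by auto
  then show "finite (UNIV :: bit set)"
    by (metis finite.emptyI finite.insertI)
qed

subsection \<open>Complex matrices\<close>

type_synonym 'n cmat = "complex^'n^'n"

definition adjoint_mat :: "'n::finite cmat \<Rightarrow> 'n cmat" where
  "adjoint_mat A = (\<chi> i j. cnj (A $ j $ i))"

definition cscale :: "complex \<Rightarrow> 'n::finite cmat \<Rightarrow> 'n cmat" where
  "cscale c A = (\<chi> i j. c * A $ i $ j)"

definition unitary_matrices :: "'n::finite cmat set" where
  "unitary_matrices = {U. U ** adjoint_mat U = mat 1 \<and> adjoint_mat U ** U = mat 1}"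

definition conjugate_by :: "'n::finite cmat \<Rightarrow> 'n cmat \<Rightarrow> 'n cmat" where
  "conjugate_by g A = g ** A ** adjoint_mat g"

text \<open>The tensor product of a finite family of matrices: the basis of the tensor product
  is indexed by families of basis indices, the index \<open>x\<close> standing for
  the tensor product of the basis vectors with indices \<open>x $ i\<close>.\<close>

definition tensor_family :: "('i::finite \<Rightarrow> 'n::finite cmat) \<Rightarrow> ('n^'i) cmat" where
  "tensor_family A = (\<chi> x y. \<Prod>i\<in>UNIV. A i $ (x $ i) $ (y $ i))"

subsection \<open>Pauli matrices and the Clifford group\<close>

definition pauli_X :: "bit cmat" where
  "pauli_X = (\<chi> i j. if i = j then 0 else 1)"

definition pauli_Z :: "bit cmat" where
  "pauli_Z = (\<chi> i j. if i = j then (if i = 0 then 1 else -1) else 0)"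

definition bit_power :: "'n::finite cmat \<Rightarrow> bit \<Rightarrow> 'n cmat" where
  "bit_power A e = (if e = 1 then A else mat 1)"

text \<open>Here \<open>m = CARD('m)\<close> and \<open>N = 2 ^ m = CARD(bit^'m)\<close>.\<close>

definition pauli_D :: "bit^'m::finite \<Rightarrow> bit^'m \<Rightarrow> (bit^'m) cmat" where
  "pauli_D a b = tensor_family (\<lambda>i. bit_power pauli_X (a $ i) ** bit_power pauli_Z (b $ i))"

definition heisenberg_weyl :: "(bit^'m::finite) cmat set" where
  "heisenberg_weyl = {cscale (\<i> ^ k) (pauli_D a b) | (k::nat) a b. True}"

text \<open>The exponent is the inner product of \<open>a\<close> and \<open>b\<close> computed in the integers, not modulo 2.\<close>

definition pauli_E :: "bit^'m::finite \<Rightarrow> bit^'m \<Rightarrow> (bit^'m) cmat" where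
  "pauli_E a b =
     cscale (\<i> ^ (\<Sum>i\<in>UNIV. of_bool (a $ i = 1) * of_bool (b $ i = 1))) (pauli_D a b)"

definition clifford_group :: "(bit^'m::finite) cmat monoid" where
  "clifford_group =
     \<lparr>carrier = {g \<in> unitary_matrices. \<forall>a b. conjugate_by g (pauli_D a b) \<in> heisenberg_weyl},
      mult = (**), one = mat 1\<rparr>"

subsection \<open>The Heisenberg-Weyl graph\<close>

text \<open>The vertex labeled by the pair of \<open>E(a,b)\<close> and \<open>-E(a,b)\<close> is the two-element set of
  these matrices, so that a Clifford element \<open>g\<close> acts on vertices by the image under
  conjugation by \<open>g\<close>.\<close>

definition hw_vertices :: "(bit^'m::finite) cmat set set" where
  "hw_vertices = {{pauli_E a b, - pauli_E a b} | a b. (a, b) \<noteq> (0, 0)}"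

definition hw_adjacent :: "(bit^'m::finite) cmat set \<Rightarrow> (bit^'m) cmat set \<Rightarrow> bool" where
  "hw_adjacent u v \<longleftrightarrow> u \<in> hw_vertices \<and> v \<in> hw_vertices \<and> u \<noteq> v \<and>
     (\<forall>A\<in>u. \<forall>B\<in>v. A ** B = B ** A)"

definition hw_nonadjacent :: "(bit^'m::finite) cmat set \<Rightarrow> (bit^'m) cmat set \<Rightarrow> bool" where
  "hw_nonadjacent u v \<longleftrightarrow> u \<in> hw_vertices \<and> v \<in> hw_vertices \<and> u \<noteq> v \<and> \<not> hw_adjacent u v"

definition unordered_pairs :: "('v \<Rightarrow> 'v \<Rightarrow> bool) \<Rightarrow> 'v set set" where
  "unordered_pairs R = {{u, v} | u v. R u v}"

definition ordered_pairs :: "('v \<Rightarrow> 'v \<Rightarrow> bool) \<Rightarrow> ('v \<times> 'v) set" where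
  "ordered_pairs R = {(u, v). R u v}"

definition act_vertex :: "(bit^'m::finite) cmat \<Rightarrow> (bit^'m) cmat set \<Rightarrow> (bit^'m) cmat set" where
  "act_vertex g v = conjugate_by g ` v"

definition transitive_on :: "'g set \<Rightarrow> ('g \<Rightarrow> 's \<Rightarrow> 's) \<Rightarrow> 's set \<Rightarrow> bool" where
  "transitive_on G act S \<longleftrightarrow> (\<forall>x\<in>S. \<forall>y\<in>S. \<exists>g\<in>G. act g x = y)"

text \<open>Transitivity on edges and non-edges, viewed as unordered pairs of vertices (the first
  predicate) or as ordered pairs (the second). For \<open>N = 2\<close> they differ: the
  group generated by the Pauli matrices and a Clifford element permuting \<open>X\<close>, \<open>Y\<close>, \<open>Z\<close>
  cyclically (up to sign) satisfies the first one and not the second, and it is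
  not a unitary 3-design.\<close>

definition edge_nonedge_transitive :: "(bit^'m::finite) cmat set \<Rightarrow> bool" where
  "edge_nonedge_transitive G \<longleftrightarrow>
     transitive_on G (\<lambda>g e. act_vertex g ` e) (unordered_pairs hw_adjacent) \<and>
     transitive_on G (\<lambda>g e. act_vertex g ` e) (unordered_pairs hw_nonadjacent)"

definition ordered_edge_nonedge_transitive :: "(bit^'m::finite) cmat set \<Rightarrow> bool" where
  "ordered_edge_nonedge_transitive G \<longleftrightarrow>
     transitive_on G (\<lambda>g (u, v). (act_vertex g u, act_vertex g v)) (ordered_pairs hw_adjacent) \<and>
     transitive_on G (\<lambda>g (u, v). (act_vertex g u, act_vertex g v)) (ordered_pairs hw_nonadjacent)"

subsection \<open>Unitary designs\<close>

definition is_haar_unitary :: "'n::finite cmat measure \<Rightarrow> bool" where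
  "is_haar_unitary \<eta> \<longleftrightarrow> prob_space \<eta> \<and>
     sets \<eta> = sets (restrict_space borel unitary_matrices) \<and>
     (\<forall>V\<in>unitary_matrices. distr \<eta> \<eta> (\<lambda>U. V ** U) = \<eta>)"

definition is_ensemble :: "'i set \<Rightarrow> ('i \<Rightarrow> real) \<Rightarrow> ('i \<Rightarrow> 'n::finite cmat) \<Rightarrow> bool" where
  "is_ensemble I p U \<longleftrightarrow> finite I \<and> (\<forall>i\<in>I. 0 \<le> p i) \<and> (\<Sum>i\<in>I. p i) = 1 \<and>
     (\<forall>i\<in>I. U i \<in> unitary_matrices)"

definition tensor_power :: "'n::finite cmat \<Rightarrow> ('n^'k::finite) cmat" where
  "tensor_power U = tensor_family (\<lambda>_. U)"

text \<open>The parameter \<open>k\<close> of the design is \<open>CARD('k)\<close>. The argument \<open>\<eta>\<close> is meant to be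
  the Haar measure.\<close>

definition unitary_design ::
  "'k::finite itself \<Rightarrow> 'n::finite cmat measure \<Rightarrow> 'i set \<Rightarrow> ('i \<Rightarrow> real) \<Rightarrow> ('i \<Rightarrow> 'n cmat) \<Rightarrow> bool"
  where
  "unitary_design _ \<eta> I p U \<longleftrightarrow> is_ensemble I p U \<and>
     (\<forall>X :: ('n^'k) cmat.
        (\<Sum>i\<in>I. p i *\<^sub>R (tensor_power (U i) ** X ** tensor_power (adjoint_mat (U i)))) =
        (\<integral>V. tensor_power V ** X ** tensor_power (adjoint_mat V) \<partial>\<eta>))"

end

theory Submission
  imports Defs
begin

text \<open>Twirling over \<open>G\<close> and twirling over the Haar measure agree as soon as every \<open>G\<close>-twirl commutes
  with all tensor powers of unitaries. By linearity it suffices to twirl tensor products of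
  Pauli matrices, and since \<open>G\<close> contains the Pauli matrices only products with trivial total label
  survive: \<open>D\<^sub>u \<otimes> D\<^sub>u\<^sup>\<dagger>\<close> for two factors and \<open>D\<^sub>u \<otimes> D\<^sub>v \<otimes> (D\<^sub>u D\<^sub>v)\<^sup>\<dagger>\<close> for three. Conjugation by \<open>g \<in> G\<close>
  permutes these matrices without phases, so by transitivity the twirl is the average over one of
  at most two (respectively six) classes of labels, and the sum over such a class is a linear
  combination of permutation matrices of the tensor factors.

  For unordered pairs and \<open>m \<ge> 2\<close>, suppose that the edges (or the non-edges) were transitive as
  unordered but not as ordered pairs. Then one orbit of ordered pairs orients them, giving an
  antisymmetric invariant matrix \<open>A\<close> with entries 0, 1, -1. Its square is symmetric and invariant, hence
  has constant entries on edges and on non-edges; the vanishing row sums, together with parity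
  and size bounds for these two constants, lead to a contradiction.\<close>

section \<open>Complex matrices and tensor products\<close>

text \<open>The six classes of label pairs face the six permutations of three tensor factors. The
  pair \<open>(0, 0)\<close> gives the identity; each degenerate family (\<open>u = 0\<close>,
  \<open>v = 0\<close> or \<open>u = v\<close>), completed by \<open>(0, 0)\<close>, sums to a
  multiple of a transposition; the sums over all pairs, plain and weighted by the commutation sign,
  are multiples of the two 3-cycles, and half their sum or difference separates commuting from
  anticommuting pairs. For one qubit the cyclic orientation of X, Y, Z is consistent, so excluding
  orientations must use a second qubit. It enters twice: \<open>q = 4 ^ (m - 1)\<close>, the number
  of labels with prescribed commutation signs against two distinct nonzero labels, becomes even and
  at least 4, and there are four pairwise anticommuting Pauli matrices.\<close>

lemma matrix_eqI: "(\<And>i j. A $ i $ j = B $ i $ j) \<Longrightarrow> A = B"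
  by (simp add: vec_eq_iff)

lemma cscale_nth [simp]: "cscale c A $ i $ j = c * A $ i $ j"
  by (simp add: cscale_def)

lemma adjoint_mat_nth [simp]: "adjoint_mat A $ i $ j = cnj (A $ j $ i)"
  by (simp add: adjoint_mat_def)

lemma matrix_mult_nth: "(A ** B) $ i $ j = (\<Sum>k\<in>UNIV. A $ i $ k * B $ k $ j)"
  by (simp add: matrix_matrix_mult_def)

lemma cscale_cscale [simp]: "cscale a (cscale b A) = cscale (a * b) A"
  by (simp add: vec_eq_iff)

lemma cscale_1 [simp]: "cscale 1 A = A"
  by (simp add: vec_eq_iff)

lemma cscale_mult_left [simp]: "cscale a A ** B = cscale a (A ** B)"
  by (simp add: vec_eq_iff matrix_mult_nth sum_distrib_left mult.assoc)

lemma cscale_mult_right [simp]: "A ** cscale a B = cscale a (A ** B)"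
  by (simp add: vec_eq_iff matrix_mult_nth sum_distrib_left mult_ac)

lemma cscale_add: "cscale c (A + B) = cscale c A + cscale c B"
  by (simp add: vec_eq_iff algebra_simps)

lemma cscale_sum: "cscale c (sum f S) = (\<Sum>x\<in>S. cscale c (f x))"
  by (simp add: vec_eq_iff sum_distrib_left)

lemma scaleR_eq_cscale: "r *\<^sub>R A = cscale (of_real r) (A :: 'n::finite cmat)"
  by (simp add: vec_eq_iff scaleR_conv_of_real[where 'a = complex])

lemma minus_eq_cscale: "- A = cscale (- 1) (A :: 'n::finite cmat)"
  by (simp add: vec_eq_iff)

lemma matrix_mult_add_left: "(A + B) ** (C :: 'n::finite cmat) = A ** C + B ** C"
  by (simp add: vec_eq_iff matrix_mult_nth sum.distrib distrib_right)

lemma matrix_mult_sum_left: "sum f S ** (B :: 'n::finite cmat) = (\<Sum>x\<in>S. f x ** B)"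
  by (induction S rule: infinite_finite_induct) (auto simp: matrix_mult_add_left)

lemma matrix_mult_sum_right: "(B :: 'n::finite cmat) ** sum f S = (\<Sum>x\<in>S. B ** f x)"
  by (induction S rule: infinite_finite_induct) (auto simp: matrix_add_ldistrib)

lemma adjoint_adjoint [simp]: "adjoint_mat (adjoint_mat A) = A"
  by (simp add: vec_eq_iff)

lemma adjoint_mult: "adjoint_mat (A ** B) = adjoint_mat B ** adjoint_mat A"
  by (simp add: vec_eq_iff matrix_mult_nth mult.commute)

lemma adjoint_cscale [simp]: "adjoint_mat (cscale c A) = cscale (cnj c) (adjoint_mat A)"
  by (simp add: vec_eq_iff)

lemma adjoint_one [simp]: "adjoint_mat (mat 1) = mat 1"
  by (auto simp: vec_eq_iff mat_def)

lemma unitary_mult: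
  assumes "U \<in> unitary_matrices" "V \<in> unitary_matrices"
  shows "U ** V \<in> unitary_matrices"
proof -
  have "(U ** V) ** (adjoint_mat V ** adjoint_mat U) = U ** (V ** adjoint_mat V) ** adjoint_mat U"
    by (simp only: matrix_mul_assoc)
  moreover have "(adjoint_mat V ** adjoint_mat U) ** (U ** V) =
      adjoint_mat V ** (adjoint_mat U ** U) ** V"
    by (simp only: matrix_mul_assoc)
  ultimately show ?thesis
    using assms by (simp add: unitary_matrices_def adjoint_mult)
qed

lemma unitary_adjoint: "U \<in> unitary_matrices \<Longrightarrow> adjoint_mat U \<in> unitary_matrices"
  by (simp add: unitary_matrices_def)

lemma unitary_cancel:
  assumes "U \<in> unitary_matrices"
  shows "A ** adjoint_mat U ** U = A" "A ** U ** adjoint_mat U = A"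
    "adjoint_mat U ** (U ** A) = A" "U ** (adjoint_mat U ** A) = A"
proof -
  have U: "adjoint_mat U ** U = mat 1" "U ** adjoint_mat U = mat 1"
    using assms by (auto simp: unitary_matrices_def)
  show "A ** adjoint_mat U ** U = A" "A ** U ** adjoint_mat U = A"
    by (simp_all only: U matrix_mul_rid matrix_mul_assoc[symmetric])
  show "adjoint_mat U ** (U ** A) = A" "U ** (adjoint_mat U ** A) = A"
    by (simp_all only: U matrix_mul_lid matrix_mul_assoc)
qed

lemma unitary_mult_left_cancel:
  fixes A B U :: "'n::finite cmat"
  assumes "U \<in> unitary_matrices" "U ** A = U ** B"
  shows "A = B"
proof -
  have "adjoint_mat U ** (U ** A) = adjoint_mat U ** (U ** B)"
    by (simp only: assms)
  then show ?thesis
    by (simp only: unitary_cancel[OF assms(1)])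
qed

lemma unitary_mult_right_cancel:
  fixes A B U :: "'n::finite cmat"
  assumes "U \<in> unitary_matrices" "A ** U = B ** U"
  shows "A = B"
proof -
  have "A ** U ** adjoint_mat U = B ** U ** adjoint_mat U"
    by (simp only: assms)
  then show ?thesis
    by (simp only: unitary_cancel[OF assms(1)])
qed

section \<open>Tensor products and tensor powers of matrices\<close>

lemma sum_vec_prod:
  fixes f :: "'k::finite \<Rightarrow> 'n::finite \<Rightarrow> 'a::comm_semiring_1"
  shows "(\<Sum>z\<in>UNIV. \<Prod>i\<in>UNIV. f i (z $ i)) = (\<Prod>i\<in>UNIV. \<Sum>j\<in>UNIV. f i j)"
proof -
  have "(\<Prod>i\<in>UNIV. \<Sum>j\<in>UNIV. f i j) = (\<Sum>g\<in>UNIV. \<Prod>i\<in>UNIV. f i (g i))"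
    by (subst prod_sum_PiE) auto
  also have "\<dots> = (\<Sum>z\<in>UNIV. \<Prod>i\<in>UNIV. f i (z $ i))"
    by (rule sum.reindex_bij_witness[of _ "\<lambda>z. vec_nth z" vec_lambda]) auto
  finally show ?thesis by simp
qed

lemma tensor_family_nth: "tensor_family A $ x $ y = (\<Prod>i\<in>UNIV. A i $ (x $ i) $ (y $ i))"
  by (simp add: tensor_family_def)

text \<open>This is the mixed-product rule: an intermediate index is a whole family, and
  \<open>sum_vec_prod\<close> turns the sum over families into a product of factorwise sums.\<close>

lemma tensor_family_mult: "tensor_family A ** tensor_family B = tensor_family (\<lambda>i. A i ** B i)"
proof -
  have "(\<Sum>z\<in>UNIV. (\<Prod>i\<in>UNIV. A i $ (x $ i) $ (z $ i)) * (\<Prod>i\<in>UNIV. B i $ (z $ i) $ (y $ i))) =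
      (\<Prod>i\<in>UNIV. \<Sum>j\<in>UNIV. A i $ (x $ i) $ j * B i $ j $ (y $ i))" for x y
    unfolding prod.distrib[symmetric] by (rule sum_vec_prod)
  then show ?thesis
    by (simp add: vec_eq_iff matrix_mult_nth tensor_family_nth)
qed

lemma tensor_family_adjoint: "adjoint_mat (tensor_family A) = tensor_family (\<lambda>i. adjoint_mat (A i))"
  by (simp add: vec_eq_iff tensor_family_nth)

lemma tensor_family_cscale:
  "tensor_family (\<lambda>i. cscale (c i) (A i)) = cscale (\<Prod>i\<in>UNIV. c i) (tensor_family A)"
  by (simp add: vec_eq_iff tensor_family_nth prod.distrib)

lemma tensor_family_one: "tensor_family (\<lambda>_. mat 1) = mat 1"
  by (auto simp: vec_eq_iff tensor_family_nth mat_def)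

lemma tensor_power_mult: "tensor_power (U ** V) = tensor_power U ** tensor_power V"
  by (simp add: tensor_power_def tensor_family_mult)

lemma tensor_power_adjoint: "tensor_power (adjoint_mat U) = adjoint_mat (tensor_power U)"
  by (simp add: tensor_power_def tensor_family_adjoint)

lemma tensor_power_unitary:
  assumes "U \<in> unitary_matrices"
  shows "tensor_power U \<in> unitary_matrices"
  using assms by (simp add: unitary_matrices_def tensor_power_def tensor_family_mult
      tensor_family_adjoint tensor_family_one)

lemma conjugate_by_tensor_family:
  "conjugate_by (tensor_power g) (tensor_family A) = tensor_family (\<lambda>i. conjugate_by g (A i))"
  by (simp add: conjugate_by_def tensor_power_def tensor_family_mult tensor_family_adjoint)

lemma conjugate_by_mult: "conjugate_by (g ** h) A = conjugate_by g (conjugate_by h A)"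
  by (simp add: conjugate_by_def adjoint_mult matrix_mul_assoc)

lemma conjugate_by_cscale [simp]: "conjugate_by g (cscale c A) = cscale c (conjugate_by g A)"
  by (simp add: conjugate_by_def)

lemma conjugate_by_sum: "conjugate_by g (sum f S) = (\<Sum>x\<in>S. conjugate_by g (f x))"
  by (simp add: conjugate_by_def matrix_mult_sum_left matrix_mult_sum_right)

lemma conjugate_by_prod:
  assumes "g \<in> unitary_matrices"
  shows "conjugate_by g (A ** B) = conjugate_by g A ** conjugate_by g B"
proof -
  have "conjugate_by g A ** conjugate_by g B = g ** A ** (adjoint_mat g ** (g ** B)) ** adjoint_mat g"
    by (simp only: conjugate_by_def matrix_mul_assoc)
  then show ?thesis
    using assms by (simp add: unitary_cancel conjugate_by_def matrix_mul_assoc)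
qed

lemma conjugate_by_adjoint: "conjugate_by g (adjoint_mat A) = adjoint_mat (conjugate_by g A)"
  by (simp add: conjugate_by_def adjoint_mult matrix_mul_assoc)

lemma conjugate_by_inject:
  assumes "g \<in> unitary_matrices" "conjugate_by g A = conjugate_by g B"
  shows "A = B"
proof -
  have "g ** A = g ** B"
    using assms unitary_mult_right_cancel[OF unitary_adjoint] unfolding conjugate_by_def by blast
  then show ?thesis using assms unitary_mult_left_cancel by blast
qed

section \<open>Twirling and the commutant of the tensor powers\<close>

definition tensor_commutant :: "('n::finite^'k::finite) cmat set" where
  "tensor_commutant = {Y. \<forall>V\<in>unitary_matrices. tensor_power V ** Y = Y ** tensor_power V}"

lemma tensor_commutant_cscale: "Y \<in> tensor_commutant \<Longrightarrow> cscale c Y \<in> tensor_commutant"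
  by (simp add: tensor_commutant_def)

lemma tensor_commutant_add:
  "X \<in> tensor_commutant \<Longrightarrow> Y \<in> tensor_commutant \<Longrightarrow> X + Y \<in> tensor_commutant"
  by (simp add: tensor_commutant_def matrix_add_ldistrib matrix_mult_add_left)

lemma tensor_commutant_diff:
  "X \<in> tensor_commutant \<Longrightarrow> Y \<in> tensor_commutant \<Longrightarrow> X - Y \<in> tensor_commutant"
  using tensor_commutant_add[of X "cscale (- 1) Y"] tensor_commutant_cscale[of Y "- 1"]
  by (simp flip: minus_eq_cscale)

lemma tensor_commutant_0: "0 \<in> tensor_commutant"
  by (simp add: tensor_commutant_def)

lemma tensor_commutant_sum:
  "(\<And>x. x \<in> S \<Longrightarrow> f x \<in> tensor_commutant) \<Longrightarrow> sum f S \<in> tensor_commutant"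
  by (induction S rule: infinite_finite_induct) (auto intro: tensor_commutant_add tensor_commutant_0)

lemma tensor_commutant_iff_conjugate:
  "Y \<in> tensor_commutant \<longleftrightarrow> (\<forall>V\<in>unitary_matrices. conjugate_by (tensor_power V) Y = Y)"
proof -
  have "tensor_power V ** Y = Y ** tensor_power V \<longleftrightarrow> conjugate_by (tensor_power V) Y = Y"
    if "V \<in> unitary_matrices" for V
  proof
    assume "tensor_power V ** Y = Y ** tensor_power V"
    then show "conjugate_by (tensor_power V) Y = Y"
      by (simp add: conjugate_by_def unitary_cancel tensor_power_unitary that)
  next
    assume "conjugate_by (tensor_power V) Y = Y"
    then have "Y ** tensor_power V = conjugate_by (tensor_power V) Y ** tensor_power V"
      by simp
    then show "tensor_power V ** Y = Y ** tensor_power V"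
      by (simp add: conjugate_by_def unitary_cancel tensor_power_unitary that)
  qed
  then show ?thesis by (auto simp: tensor_commutant_def)
qed

definition twirl :: "'n::finite cmat set \<Rightarrow> ('n^'k::finite) cmat \<Rightarrow> ('n^'k) cmat" where
  "twirl G X = (\<Sum>g\<in>G. (1 / real (card G)) *\<^sub>R conjugate_by (tensor_power g) X)"

lemma twirl_cscale: "twirl G (cscale c X) = cscale c (twirl G X)"
  by (simp add: twirl_def scaleR_eq_cscale cscale_sum mult_ac)

lemma twirl_sum: "twirl G (sum f S) = (\<Sum>x\<in>S. twirl G (f x))"
  by (simp add: twirl_def conjugate_by_sum scaleR_sum_right) (rule sum.swap)

lemma twirl_commutant:
  assumes "finite G" "G \<noteq> {}" "G \<subseteq> unitary_matrices" "Y \<in> tensor_commutant"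
  shows "twirl G Y = Y"
proof -
  have "twirl G Y = (\<Sum>g\<in>G. (1 / real (card G)) *\<^sub>R Y)"
    unfolding twirl_def using assms
    by (intro sum.cong) (auto simp: tensor_commutant_iff_conjugate)
  then show ?thesis using assms by (simp add: sum_constant_scaleR del: sum_constant)
qed

text \<open>Right translation by \<open>h\<close> permutes the finite set \<open>G\<close>, so it
  only reorders the summands.\<close>

lemma twirl_conjugate:
  assumes "finite G" "\<And>g. g \<in> G \<Longrightarrow> g ** h \<in> G" "h \<in> unitary_matrices"
  shows "twirl G (conjugate_by (tensor_power h) X) = twirl G X"
proof -
  have inj: "inj_on (\<lambda>g. g ** h) G"
    using assms(3) unitary_mult_right_cancel by (auto intro!: inj_onI)
  then have "(\<lambda>g. g ** h) ` G = G"
    using assms(1,2) by (intro endo_inj_surj) auto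
  then have "twirl G X = (\<Sum>g\<in>(\<lambda>g. g ** h) ` G. (1 / real (card G)) *\<^sub>R conjugate_by (tensor_power g) X)"
    by (simp add: twirl_def)
  also have "\<dots> = twirl G (conjugate_by (tensor_power h) X)"
    by (subst sum.reindex[OF inj]) (simp add: twirl_def tensor_power_mult conjugate_by_mult)
  finally show ?thesis by simp
qed

text \<open>A class sum in the commutant is its own twirl, and by linearity that twirl is
  \<open>card C\<close> times the common twirl of the members; dividing by \<open>card C\<close>
  isolates a single one.\<close>

lemma twirl_orbit_commutant:
  assumes "finite G" "G \<noteq> {}" "G \<subseteq> unitary_matrices" "finite C"
    and "\<And>p q. p \<in> C \<Longrightarrow> q \<in> C \<Longrightarrow> twirl G (F p) = twirl G (F q)"
    and "(\<Sum>p\<in>C. F p) \<in> tensor_commutant" and "q \<in> C"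
  shows "twirl G (F q) \<in> tensor_commutant"
proof -
  have "(\<Sum>p\<in>C. F p) = twirl G (\<Sum>p\<in>C. F p)"
    using assms(1-3,6) by (simp add: twirl_commutant)
  also have "\<dots> = (\<Sum>p\<in>C. twirl G (F q))"
    unfolding twirl_sum by (rule sum.cong[OF refl]) (rule assms(5)[OF _ assms(7)])
  also have "\<dots> = cscale (of_nat (card C)) (twirl G (F q))"
    by (simp add: sum_constant_scaleR scaleR_eq_cscale del: sum_constant)
  finally have "twirl G (F q) = cscale (1 / of_nat (card C)) (\<Sum>p\<in>C. F p)"
    using assms(4,7) by auto
  then show ?thesis using assms(6) by (simp add: tensor_commutant_cscale)
qed

section \<open>The real inner product of complex matrices\<close>

lemma inner_complex_mult: "inner (a :: complex) (p * b) = inner (cnj p * a) b"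
  by (simp add: inner_complex_def algebra_simps)

text \<open>On matrices \<open>inner A B\<close> is the real part of the trace of
  \<open>adjoint_mat A ** B\<close>. Its definiteness later forces the difference of two twirls to
  vanish.\<close>

lemma inner_matrix_mult_left:
  fixes A :: "'n::finite cmat"
  shows "inner A (P ** B) = inner (adjoint_mat P ** A) B"
proof -
  have "inner A (P ** B) = (\<Sum>i\<in>UNIV. \<Sum>j\<in>UNIV. \<Sum>k\<in>UNIV. inner (cnj (P $ i $ k) * A $ i $ j) (B $ k $ j))"
    by (simp add: inner_vec_def matrix_mult_nth inner_sum_right inner_complex_mult)
  also have "\<dots> = (\<Sum>j\<in>UNIV. \<Sum>i\<in>UNIV. \<Sum>k\<in>UNIV. inner (cnj (P $ i $ k) * A $ i $ j) (B $ k $ j))"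
    by (rule sum.swap)
  also have "\<dots> = (\<Sum>j\<in>UNIV. \<Sum>k\<in>UNIV. \<Sum>i\<in>UNIV. inner (cnj (P $ i $ k) * A $ i $ j) (B $ k $ j))"
    by (intro sum.cong sum.swap refl)
  also have "\<dots> = (\<Sum>k\<in>UNIV. \<Sum>j\<in>UNIV. \<Sum>i\<in>UNIV. inner (cnj (P $ i $ k) * A $ i $ j) (B $ k $ j))"
    by (rule sum.swap)
  also have "\<dots> = inner (adjoint_mat P ** A) B"
    by (simp add: inner_vec_def matrix_mult_nth inner_sum_left)
  finally show ?thesis .
qed

lemma inner_adjoint:
  fixes A :: "'n::finite cmat"
  shows "inner (adjoint_mat A) (adjoint_mat B) = inner A B"
  unfolding inner_vec_def by (subst sum.swap) (simp add: inner_complex_def)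

lemma inner_matrix_mult_right:
  fixes A :: "'n::finite cmat"
  shows "inner A (B ** P) = inner (A ** adjoint_mat P) B"
proof -
  have "inner A (B ** P) = inner (adjoint_mat A) (adjoint_mat P ** adjoint_mat B)"
    by (simp only: inner_adjoint flip: adjoint_mult)
  also have "\<dots> = inner (adjoint_mat (A ** adjoint_mat P)) (adjoint_mat B)"
    by (simp only: inner_matrix_mult_left adjoint_mult)
  finally show ?thesis
    by (simp only: inner_adjoint)
qed

lemma inner_conjugate_by: "inner Y (conjugate_by P X) = inner (conjugate_by (adjoint_mat P) Y) X"
proof -
  have "inner Y (conjugate_by P X) = inner (Y ** P) (P ** X)"
    unfolding conjugate_by_def by (subst inner_matrix_mult_right) simp
  also have "\<dots> = inner (conjugate_by (adjoint_mat P) Y) X"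
    by (simp add: inner_matrix_mult_left conjugate_by_def matrix_mul_assoc)
  finally show ?thesis .
qed

text \<open>The conjugation moves to \<open>Y\<close> as conjugation by the adjoint, which fixes
  \<open>Y\<close>. Averaging over unitaries therefore leaves the pairing with \<open>Y\<close>
  unchanged.\<close>

lemma inner_conjugate_commutant:
  assumes "Y \<in> tensor_commutant" "V \<in> unitary_matrices"
  shows "inner Y (conjugate_by (tensor_power V) X) = inner Y X"
  using assms
  by (simp add: inner_conjugate_by tensor_commutant_iff_conjugate unitary_adjoint
      flip: tensor_power_adjoint)

lemma inner_twirl_commutant:
  assumes "finite G" "G \<noteq> {}" "G \<subseteq> unitary_matrices" "Y \<in> tensor_commutant"
  shows "inner Y (twirl G X) = inner Y X"
proof -
  have "inner Y (twirl G X) = (\<Sum>g\<in>G. (1 / real (card G)) * inner Y X)"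
    unfolding twirl_def inner_sum_right inner_scaleR_right using assms
    by (intro sum.cong) (auto simp: inner_conjugate_commutant)
  then show ?thesis using assms by simp
qed

section \<open>A design criterion\<close>

lemma continuous_on_adjoint_mat: "continuous_on S (adjoint_mat :: 'n::finite cmat \<Rightarrow> _)"
  unfolding adjoint_mat_def by (intro continuous_intros)

lemma continuous_on_matrix_mult [continuous_intros]:
  fixes f g :: "'a::topological_space \<Rightarrow> 'n::finite cmat"
  assumes "continuous_on S f" "continuous_on S g"
  shows "continuous_on S (\<lambda>x. f x ** g x)"
  unfolding matrix_matrix_mult_def by (intro continuous_intros assms)

lemma continuous_on_tensor_power: "continuous_on S (tensor_power :: 'n::finite cmat \<Rightarrow> ('n^'k::finite) cmat)"
  unfolding tensor_power_def tensor_family_def by (intro continuous_intros)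

lemma continuous_on_conjugate_tensor_power:
  "continuous_on S (\<lambda>V :: 'n::finite cmat. conjugate_by (tensor_power V) (X :: ('n^'k::finite) cmat))"
proof -
  have "continuous_on S (\<lambda>V :: 'n cmat. tensor_power (adjoint_mat V) :: ('n^'k) cmat)"
    by (rule continuous_on_compose2[OF continuous_on_tensor_power continuous_on_adjoint_mat]) auto
  then show ?thesis
    unfolding conjugate_by_def tensor_power_adjoint
    by (intro continuous_intros continuous_on_tensor_power) (simp flip: tensor_power_adjoint)
qed

lemma norm_vec_le_sum: "norm (x :: 'a::real_normed_vector^'n) \<le> (\<Sum>i\<in>UNIV. norm (x $ i))"
  unfolding norm_vec_def by (rule L2_set_le_sum) simp

lemma unitary_norm_le:
  assumes "U \<in> (unitary_matrices :: 'n::finite cmat set)"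
  shows "norm U \<le> real CARD('n) * real CARD('n)"
proof -
  have entry: "norm (U $ i $ j) \<le> 1" for i j
  proof -
    \<comment> \<open>A diagonal entry of \<open>U ** adjoint_mat U\<close> is the squared norm of a
      row, so rows are unit vectors.\<close>
    have "complex_of_real (\<Sum>k\<in>UNIV. (norm (U $ i $ k))\<^sup>2) = (U ** adjoint_mat U) $ i $ i"
      by (simp add: matrix_mult_nth flip: complex_norm_square)
    also have "\<dots> = 1"
      using assms by (simp add: unitary_matrices_def mat_def)
    finally have "(\<Sum>k\<in>UNIV. (norm (U $ i $ k))\<^sup>2) = 1"
      using of_real_eq_1_iff by blast
    moreover have "(norm (U $ i $ j))\<^sup>2 \<le> (\<Sum>k\<in>UNIV. (norm (U $ i $ k))\<^sup>2)"
      by (rule member_le_sum) auto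
    ultimately show ?thesis
      by (simp add: power_le_one_iff abs_square_le_1)
  qed
  have "norm U \<le> (\<Sum>i\<in>UNIV. norm (U $ i))"
    by (rule norm_vec_le_sum)
  also have "\<dots> \<le> (\<Sum>i\<in>(UNIV :: 'n set). \<Sum>j\<in>(UNIV :: 'n set). 1)"
    by (intro sum_mono order_trans[OF norm_vec_le_sum] entry)
  finally show ?thesis by simp
qed

lemma compact_unitary_matrices: "compact (unitary_matrices :: 'n::finite cmat set)"
proof -
  have "closed {U :: 'n cmat. U ** adjoint_mat U = mat 1}" "closed {U :: 'n cmat. adjoint_mat U ** U = mat 1}"
    by (intro closed_Collect_eq continuous_intros continuous_on_adjoint_mat)+
  then have "closed (unitary_matrices :: 'n cmat set)"
    unfolding unitary_matrices_def by (simp add: closed_Int Collect_conj_eq)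
  moreover have "bounded (unitary_matrices :: 'n cmat set)"
    unfolding bounded_iff using unitary_norm_le by blast
  ultimately show ?thesis by (simp add: compact_eq_bounded_closed)
qed

section \<open>Integration against an invariant probability measure\<close>

context
  fixes \<eta> :: "'n::finite cmat measure"
  assumes haar: "is_haar_unitary \<eta>"
begin

lemma haar_prob: "prob_space \<eta>"
  using haar by (simp add: is_haar_unitary_def)

lemma haar_sets: "sets \<eta> = sets (restrict_space borel unitary_matrices)"
  using haar by (simp add: is_haar_unitary_def)

lemma haar_space: "space \<eta> = unitary_matrices"
  using sets_eq_imp_space_eq[OF haar_sets] by (simp add: space_restrict_space)

lemma haar_measurable_continuous:
  fixes f :: "'n cmat \<Rightarrow> 'a::{second_countable_topology, real_normed_vector}"
  assumes "continuous_on UNIV f"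
  shows "f \<in> borel_measurable \<eta>"
proof -
  have "f \<in> borel_measurable (restrict_space borel unitary_matrices)"
    using assms by (intro measurable_restrict_space1 borel_measurable_continuous_onI)
  then show ?thesis
    using measurable_cong_sets[OF haar_sets refl] by blast
qed

text \<open>A continuous function is bounded on the compact unitary group, which is the whole space
  of \<open>\<eta>\<close>, and a bounded measurable function is integrable for a probability
  measure.\<close>

lemma haar_integrable_continuous:
  fixes f :: "'n cmat \<Rightarrow> 'a::euclidean_space"
  assumes "continuous_on UNIV f"
  shows "integrable \<eta> f"
proof -
  interpret prob_space \<eta> by (rule haar_prob)
  have "bounded (f ` unitary_matrices)"
    using assms compact_unitary_matrices
    by (meson compact_continuous_image compact_imp_bounded continuous_on_subset subset_UNIV)
  then obtain B where "\<And>V. V \<in> unitary_matrices \<Longrightarrow> norm (f V) \<le> B"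
    unfolding bounded_iff by blast
  then have "AE V in \<eta>. norm (f V) \<le> B"
    by (intro AE_I2) (simp add: haar_space)
  then show ?thesis
    using haar_measurable_continuous[OF assms] by (rule integrable_const_bound)
qed

lemma haar_integral_left_mult:
  fixes f :: "'n cmat \<Rightarrow> 'a::euclidean_space"
  assumes "continuous_on UNIV f" "W \<in> unitary_matrices"
  shows "(\<integral>V. f (W ** V) \<partial>\<eta>) = (\<integral>V. f V \<partial>\<eta>)"
proof -
  have "(\<lambda>V. W ** V) \<in> measurable \<eta> (restrict_space borel unitary_matrices)"
    using assms(2)
    by (intro measurable_restrict_space2 haar_measurable_continuous continuous_intros)
      (auto simp: haar_space unitary_mult)
  then have meas: "(\<lambda>V. W ** V) \<in> measurable \<eta> \<eta>"
    using measurable_cong_sets[OF refl haar_sets] by blast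
  have "(\<integral>V. f V \<partial>\<eta>) = (\<integral>V. f V \<partial>(distr \<eta> \<eta> (\<lambda>U. W ** U)))"
    using haar assms(2) by (simp add: is_haar_unitary_def)
  also have "\<dots> = (\<integral>V. f (W ** V) \<partial>\<eta>)"
    by (rule integral_distr[OF meas haar_measurable_continuous[OF assms(1)]])
  finally show ?thesis by simp
qed

definition haar_twirl :: "('n^'k::finite) cmat \<Rightarrow> ('n^'k) cmat" where
  "haar_twirl X = (\<integral>V. conjugate_by (tensor_power V) X \<partial>\<eta>)"

lemma haar_twirl_commutant: "haar_twirl X \<in> tensor_commutant"
  unfolding tensor_commutant_iff_conjugate
proof
  fix W :: "'n cmat"
  assume W: "W \<in> unitary_matrices"
  have lin: "bounded_linear (conjugate_by (tensor_power W) :: ('n^'k) cmat \<Rightarrow> _)"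
  proof (intro linear_conv_bounded_linear[THEN iffD1] linearI)
    show "conjugate_by (tensor_power W) (A + B) =
        conjugate_by (tensor_power W) A + conjugate_by (tensor_power W) B" for A B :: "('n^'k) cmat"
      by (simp add: conjugate_by_def matrix_add_ldistrib matrix_mult_add_left)
    show "conjugate_by (tensor_power W) (r *\<^sub>R A) = r *\<^sub>R conjugate_by (tensor_power W) A"
      for r and A :: "('n^'k) cmat"
      by (simp add: scaleR_eq_cscale)
  qed
  have "conjugate_by (tensor_power W) (haar_twirl X) =
      (\<integral>V. conjugate_by (tensor_power W) (conjugate_by (tensor_power V) X) \<partial>\<eta>)"
    unfolding haar_twirl_def
    by (rule integral_bounded_linear[OF lin, symmetric])
      (intro haar_integrable_continuous continuous_on_conjugate_tensor_power)
  also have "\<dots> = (\<integral>V. conjugate_by (tensor_power (W ** V)) X \<partial>\<eta>)"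
    by (simp add: tensor_power_mult conjugate_by_mult)
  also have "\<dots> = haar_twirl X"
    unfolding haar_twirl_def
    by (rule haar_integral_left_mult[OF continuous_on_conjugate_tensor_power W])
  finally show "conjugate_by (tensor_power W) (haar_twirl X) = haar_twirl X" .
qed

lemma inner_haar_twirl_commutant:
  fixes Y :: "('n^'k::finite) cmat"
  assumes "Y \<in> tensor_commutant"
  shows "inner Y (haar_twirl X) = inner Y X"
proof -
  interpret prob_space \<eta> by (rule haar_prob)
  have "inner Y (haar_twirl X) = (\<integral>V. inner Y (conjugate_by (tensor_power V) X) \<partial>\<eta>)"
    unfolding haar_twirl_def
    by (rule integral_inner_right[symmetric])
      (intro haar_integrable_continuous continuous_on_conjugate_tensor_power)
  also have "\<dots> = (\<integral>V. inner Y X \<partial>\<eta>)"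
    using assms by (intro Bochner_Integration.integral_cong)
      (auto simp: haar_space inner_conjugate_commutant)
  finally show ?thesis by (simp add: prob_space)
qed

text \<open>The difference of the two twirls of \<open>X\<close> lies in the commutant and is orthogonal to it,
  because both twirls act as the orthogonal projection when tested against the commutant.\<close>

lemma unitary_design_if_twirl_commutant:
  assumes G: "finite G" "G \<noteq> {}" "G \<subseteq> unitary_matrices"
    and twirl: "\<And>X :: ('n^'k::finite) cmat. twirl G X \<in> tensor_commutant"
  shows "unitary_design TYPE('k) \<eta> G (\<lambda>_. 1 / real (card G)) (\<lambda>U. U)"
proof -
  have "twirl G X = haar_twirl X" for X :: "('n^'k) cmat"
  proof -
    define Y where "Y = twirl G X - haar_twirl X"
    have "Y \<in> tensor_commutant"
      unfolding Y_def by (intro tensor_commutant_diff twirl haar_twirl_commutant)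
    then have "inner Y Y = 0"
      unfolding Y_def inner_diff_right[of _ "twirl G X" "haar_twirl X"]
      by (simp add: inner_twirl_commutant[OF G] inner_haar_twirl_commutant)
    then show ?thesis by (simp add: Y_def)
  qed
  then show ?thesis
    using G by (auto simp: unitary_design_def is_ensemble_def twirl_def haar_twirl_def
        conjugate_by_def tensor_power_adjoint)
qed

end

section \<open>Signs and characters\<close>

text \<open>The additive character of \<open>y\<close> given by -1 to the power of the inner product
  of \<open>b\<close> and \<open>y\<close>. Integer values keep the later counts in
  \<open>int\<close>; matrix entries use its image under \<open>of_int\<close>.\<close>

definition bit_sign :: "bit^'m::finite \<Rightarrow> bit^'m \<Rightarrow> int" where
  "bit_sign b y = (\<Prod>i\<in>UNIV. if b $ i = 1 \<and> y $ i = 1 then - 1 else 1)"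

lemma bit_cases_0_1: "(x :: bit) = 0 \<or> x = 1"
  by (cases x) auto

lemma UNIV_bit: "(UNIV :: bit set) = {0, 1}"
  using bit_cases_0_1 by auto

lemma CARD_bit [simp]: "CARD(bit) = 2"
  by (simp add: UNIV_bit)

lemma bit_add_self [simp]: "(x :: bit) + x = 0"
  using bit_cases_0_1[of x] by auto

lemma bit_vec_add_self [simp]: "(x :: bit^'m) + x = 0"
  by (simp add: vec_eq_iff)

lemma bit_vec_add_self_left [simp]: "(x :: bit^'m) + (x + y) = y"
  by (simp flip: add.assoc)

lemma bit_vec_eq_add_iff: "(x :: bit^'m) = y + a \<longleftrightarrow> a = x + y"
  by (metis add.commute bit_vec_add_self_left)

lemma bit_sign_commute: "bit_sign b y = bit_sign y b"
  unfolding bit_sign_def by (intro prod.cong) auto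

lemma bit_sign_add_right: "bit_sign b (y + z) = bit_sign b y * bit_sign b z"
proof -
  have "(if b $ i = 1 \<and> (y + z) $ i = 1 then - 1 else 1) =
      (if b $ i = 1 \<and> y $ i = 1 then - 1 else 1) * (if b $ i = 1 \<and> z $ i = 1 then - 1 else 1 :: int)" for i
    using bit_cases_0_1[of "y $ i"] bit_cases_0_1[of "z $ i"] by auto
  then show ?thesis by (simp add: bit_sign_def prod.distrib)
qed

lemma bit_sign_add_left: "bit_sign (y + z) b = bit_sign y b * bit_sign z b"
  by (metis bit_sign_commute bit_sign_add_right)

lemma bit_sign_0 [simp]: "bit_sign 0 b = 1" "bit_sign b 0 = 1"
  by (simp_all add: bit_sign_def)

lemma bit_sign_cases: "bit_sign b y = 1 \<or> bit_sign b y = - 1"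
proof -
  have "bit_sign b y * bit_sign b y = 1"
    by (simp flip: bit_sign_add_right)
  then show ?thesis by (metis zmult_eq_1_iff)
qed

lemma bit_sign_square [simp]: "bit_sign b y * bit_sign b y = 1" "bit_sign b y * (bit_sign b y * z) = z"
  using bit_sign_cases[of b y] by auto

lemma bit_sign_axis: "bit_sign b (axis i 1) = (if b $ i = 1 then - 1 else 1)"
proof -
  have "bit_sign b (axis i 1) = (\<Prod>j\<in>UNIV. if j = i then (if b $ i = 1 then - 1 else 1) else 1)"
    unfolding bit_sign_def by (intro prod.cong) (auto simp: axis_def)
  then show ?thesis by simp
qed

lemma bit_sign_nontrivial:
  assumes "b \<noteq> 0"
  obtains y where "bit_sign b y = - 1"
proof -
  obtain i where "b $ i \<noteq> 0" using assms by (auto simp: vec_eq_iff)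
  then have "b $ i = 1" using bit_cases_0_1 by blast
  then have "bit_sign b (axis i 1) = - 1" by (simp add: bit_sign_axis)
  then show ?thesis using that by blast
qed

text \<open>Translating the summation index by \<open>w\<close> multiplies the sum by
  \<open>\<psi> w\<close>, and in a domain the nonzero factor \<open>1 - \<psi> w\<close>
  cancels.\<close>

lemma sum_character_eq_0:
  fixes \<psi> :: "'a::{finite,ab_group_add} \<Rightarrow> 'b::idom"
  assumes hom: "\<And>u v. \<psi> (u + v) = \<psi> u * \<psi> v" and "\<psi> w \<noteq> 1"
  shows "(\<Sum>v\<in>UNIV. \<psi> v) = 0"
proof -
  have "(\<Sum>v\<in>UNIV. \<psi> v) = (\<Sum>v\<in>UNIV. \<psi> (w + v))"
    by (rule sum.reindex_bij_witness[of _ "\<lambda>v. w + v" "\<lambda>v. v - w"]) auto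
  then have "(1 - \<psi> w) * (\<Sum>v\<in>UNIV. \<psi> v) = 0"
    by (simp add: hom left_diff_distrib flip: sum_distrib_left)
  then show ?thesis using assms by auto
qed

lemma sum_bit_sign:
  "(\<Sum>b\<in>UNIV. bit_sign b (y :: bit^'m::finite)) = (if y = 0 then 2 ^ CARD('m) else 0)"
proof (cases "y = 0")
  case True
  then show ?thesis by simp
next
  case False
  then obtain w where "bit_sign w y = - 1"
    by (metis bit_sign_commute bit_sign_nontrivial)
  then show ?thesis
    using False by (simp add: sum_character_eq_0[of _ w] bit_sign_add_left)
qed

text \<open>The label \<open>u = (a, b)\<close> stands for the Pauli matrix \<open>D(a,b)\<close>; the form below is the sign
  by which \<open>D\<^sub>u\<close> and \<open>D\<^sub>v\<close> commute.\<close>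

type_synonym 'm label = "(bit^'m) \<times> (bit^'m)"

definition commutation_sign :: "'m::finite label \<Rightarrow> 'm label \<Rightarrow> int" where
  "commutation_sign u v = bit_sign (snd u) (fst v) * bit_sign (snd v) (fst u)"

lemma label_add_self [simp]: "(u :: 'm::finite label) + u = 0"
  by (simp add: prod_eq_iff)

lemma label_add_self_left [simp]: "(u :: 'm::finite label) + (u + v) = v"
  by (simp add: prod_eq_iff)

lemma label_add_eq_0_iff [simp]: "(u :: 'm::finite label) + v = 0 \<longleftrightarrow> u = v"
  by (metis label_add_self label_add_self_left add_0_right)

lemma commutation_sign_commute: "commutation_sign u v = commutation_sign v u"
  by (simp add: commutation_sign_def)

lemma commutation_sign_add_right:
  "commutation_sign u (v + w) = commutation_sign u v * commutation_sign u w"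
  by (simp add: commutation_sign_def bit_sign_add_right bit_sign_add_left)

lemma commutation_sign_add_left:
  "commutation_sign (v + w) u = commutation_sign v u * commutation_sign w u"
  by (metis commutation_sign_commute commutation_sign_add_right)

lemma commutation_sign_0 [simp]: "commutation_sign 0 u = 1" "commutation_sign u 0 = 1"
  by (simp_all add: commutation_sign_def)

lemma commutation_sign_self [simp]: "commutation_sign u u = 1"
  by (simp add: commutation_sign_def)

lemma commutation_sign_cases: "commutation_sign u v = 1 \<or> commutation_sign u v = - 1"
  using bit_sign_cases[of "snd u" "fst v"] bit_sign_cases[of "snd v" "fst u"]
  by (auto simp: commutation_sign_def)

text \<open>The symplectic form is nondegenerate: a pure X label detects a nonzero Z part, and a
  pure Z label detects the X part when the Z part vanishes.\<close>

lemma commutation_sign_nontrivial: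
  assumes "u \<noteq> 0"
  obtains v where "commutation_sign v u = - 1"
proof (cases "snd u = 0")
  case True
  then obtain y where "bit_sign (fst u) y = - 1"
    using assms bit_sign_nontrivial[of "fst u"] by (auto simp: prod_eq_iff)
  then have "commutation_sign (0, y) u = - 1"
    using True by (simp add: commutation_sign_def bit_sign_commute)
  then show ?thesis using that by blast
next
  case False
  then obtain y where "bit_sign (snd u) y = - 1"
    using bit_sign_nontrivial by blast
  then have "commutation_sign (y, 0) u = - 1"
    by (simp add: commutation_sign_def)
  then show ?thesis using that by blast
qed

section \<open>Pauli matrices\<close>

definition pauli :: "'m::finite label \<Rightarrow> (bit^'m) cmat" where
  "pauli u = pauli_D (fst u) (snd u)"

text \<open>X shifts a basis index and Z multiplies by a sign, so each column has a single nonzero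
  entry. This reduces the Pauli calculus to arithmetic with labels and signs.\<close>

lemma pauli_nth:
  "pauli u $ x $ y = (if x = y + fst u then of_int (bit_sign (snd u) y) else 0)"
proof -
  have one: "(bit_power pauli_X a ** bit_power pauli_Z b) $ s $ t =
      (if s = t + a then of_int (if b = 1 \<and> t = 1 then - 1 else 1) else 0)" for a b s t :: bit
  proof -
    show ?thesis
      using bit_cases_0_1[of a] bit_cases_0_1[of b] bit_cases_0_1[of s] bit_cases_0_1[of t]
      by (auto simp: matrix_mult_nth UNIV_bit bit_power_def pauli_X_def pauli_Z_def mat_def)
  qed
  have "pauli u $ x $ y = (\<Prod>i\<in>UNIV. if x $ i = y $ i + fst u $ i
      then of_int (if snd u $ i = 1 \<and> y $ i = 1 then - 1 else 1) else 0)"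
    by (simp only: pauli_def pauli_D_def tensor_family_nth one)
  also have "\<dots> = (if x = y + fst u then of_int (bit_sign (snd u) y) else 0)"
  proof (cases "x = y + fst u")
    case True
    then show ?thesis by (simp add: bit_sign_def)
  next
    case False
    then obtain i where "x $ i \<noteq> y $ i + fst u $ i" by (auto simp: vec_eq_iff)
    then have "\<exists>i\<in>UNIV. (if x $ i = y $ i + fst u $ i
        then complex_of_int (if snd u $ i = 1 \<and> y $ i = 1 then - 1 else 1) else 0) = 0"
      by (intro bexI[of _ i]) (simp_all only: if_False UNIV_I)
    then show ?thesis
      by (simp only: False if_False prod_zero finite_class.finite_UNIV)
  qed
  finally show ?thesis .
qed

lemma pauli_nth_eq:
  "pauli u $ x $ y = (if fst u = x + y then of_int (bit_sign (snd u) y) else 0)"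
  by (simp only: pauli_nth bit_vec_eq_add_iff[of x y])

text \<open>The sign comes from moving the Z part of \<open>u\<close> past the X part of
  \<open>v\<close>.\<close>

lemma pauli_mult:
  "pauli u ** pauli v = cscale (of_int (bit_sign (snd u) (fst v))) (pauli (u + v))"
proof -
  have "(\<Sum>z\<in>UNIV. pauli u $ x $ z * pauli v $ z $ y) =
      of_int (bit_sign (snd u) (fst v)) * pauli (u + v) $ x $ y" for x y
  proof -
    have eq: "(\<Sum>z\<in>UNIV. pauli u $ x $ z * pauli v $ z $ y) =
        (\<Sum>z\<in>UNIV. if z = y + fst v then pauli u $ x $ z * of_int (bit_sign (snd v) y) else 0)"
      by (intro sum.cong) (auto simp: pauli_nth)
    show ?thesis
      unfolding eq by (simp add: pauli_nth bit_sign_add_right bit_sign_add_left ac_simps)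
  qed
  then show ?thesis by (simp add: vec_eq_iff matrix_mult_nth)
qed

lemma pauli_0: "pauli (0 :: 'm::finite label) = mat 1"
proof -
  have "pauli 0 $ x $ y = (if x = y then 1 else 0)" for x y :: "bit^'m"
    by (simp add: pauli_nth)
  then show ?thesis by (simp only: vec_eq_iff mat_def vec_lambda_beta) simp
qed

lemma pauli_adjoint: "adjoint_mat (pauli u) = cscale (of_int (bit_sign (snd u) (fst u))) (pauli u)"
proof -
  have "cnj (pauli u $ y $ x) = of_int (bit_sign (snd u) (fst u)) * pauli u $ x $ y" for x y
  proof (cases "fst u = x + y")
    case True
    have "bit_sign (snd u) x = bit_sign (snd u) (fst u) * bit_sign (snd u) y"
      by (simp add: True bit_sign_add_right mult.commute)
    with True show ?thesis by (simp add: pauli_nth_eq add.commute)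
  next
    case False
    then show ?thesis by (simp add: pauli_nth_eq add.commute[of y x])
  qed
  then show ?thesis by (simp add: vec_eq_iff)
qed

lemma pauli_unitary: "pauli u \<in> unitary_matrices"
  by (simp add: unitary_matrices_def pauli_adjoint pauli_mult pauli_0 flip: of_int_mult)

lemma pauli_commute: "pauli u ** pauli v = cscale (of_int (commutation_sign u v)) (pauli v ** pauli u)"
  by (simp add: pauli_mult commutation_sign_def add.commute mult.assoc flip: of_int_mult)

lemma conjugate_by_pauli:
  "conjugate_by (pauli u) (pauli v) = cscale (of_int (commutation_sign u v)) (pauli v)"
proof -
  have "conjugate_by (pauli u) (pauli v) =
      cscale (of_int (commutation_sign u v)) (pauli v ** pauli u ** adjoint_mat (pauli u))"
    unfolding conjugate_by_def by (subst pauli_commute) simp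
  then show ?thesis by (simp add: unitary_cancel pauli_unitary)
qed

lemma cscale_pauli_eqD:
  assumes "cscale c (pauli u) = cscale d (pauli v)" "c \<noteq> 0"
  shows "u = v" "c = d"
proof -
  have eq: "c * pauli u $ x $ y = d * pauli v $ x $ y" for x y
    using assms(1) by (metis cscale_nth)
  have nz: "complex_of_int (bit_sign b y) \<noteq> 0" for b y :: "bit^'a"
    using bit_sign_cases[of b y] by auto
  \<comment> \<open>Column 0 carries no sign, so its nonzero entry reveals both the X part and the
    scalar.\<close>
  have fst: "fst u = fst v"
    using eq[of "fst u" 0] assms(2) by (auto simp: pauli_nth split: if_splits)
  then show cd: "c = d"
    using eq[of "fst u" 0] by (simp add: pauli_nth)
  \<comment> \<open>The remaining columns compare the characters of the two Z parts, and a character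
    that is 1 everywhere has label 0.\<close>
  have "bit_sign (snd u) y = bit_sign (snd v) y" for y
    using eq[of "y + fst u" y] fst assms(2) by (simp add: pauli_nth cd)
  then have "bit_sign (snd u + snd v) y = 1" for y
    by (simp add: bit_sign_add_left)
  then have "snd u + snd v = 0"
    using bit_sign_nontrivial[of "snd u + snd v"] by (metis one_neq_neg_one)
  then have "snd u = snd v"
    by (metis add_0_right bit_vec_add_self_left)
  then show "u = v" using fst by (simp add: prod_eq_iff)
qed

lemma pauli_commute_iff: "pauli u ** pauli v = pauli v ** pauli u \<longleftrightarrow> commutation_sign u v = 1"
proof
  assume "pauli u ** pauli v = pauli v ** pauli u"
  then have eq: "cscale (of_int (commutation_sign u v)) (pauli v ** pauli u) = pauli v ** pauli u"
    by (simp flip: pauli_commute)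
  have "cscale (of_int (commutation_sign u v) * of_int (bit_sign (snd v) (fst u))) (pauli (v + u)) =
      cscale (of_int (bit_sign (snd v) (fst u))) (pauli (v + u))"
    using eq by (simp add: pauli_mult)
  moreover have "complex_of_int (commutation_sign u v) * of_int (bit_sign (snd v) (fst u)) \<noteq> 0"
    using commutation_sign_cases[of u v] bit_sign_cases[of "snd v" "fst u"] by auto
  ultimately have "complex_of_int (commutation_sign u v) * of_int (bit_sign (snd v) (fst u)) =
      of_int (bit_sign (snd v) (fst u))"
    by (rule cscale_pauli_eqD(2))
  then show "commutation_sign u v = 1"
    using commutation_sign_cases[of u v] bit_sign_cases[of "snd v" "fst u"] by auto
next
  assume "commutation_sign u v = 1"
  then show "pauli u ** pauli v = pauli v ** pauli u"
    by (subst pauli_commute) simp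
qed

text \<open>In entries this says that the Pauli matrices form an orthogonal basis: the sum over X
  parts forces \<open>x + y = z + w\<close>, and the character sum over Z parts forces
  \<open>y = w\<close>. All permutation matrices obtained below come from this identity.\<close>

lemma pauli_completeness:
  fixes x y z w :: "bit^'m::finite"
  shows "(\<Sum>u\<in>UNIV. pauli u $ x $ y * cnj (pauli u $ z $ w)) = (if x = z \<and> y = w then 2 ^ CARD('m) else 0)"
proof -
  have "(\<Sum>u\<in>UNIV. pauli u $ x $ y * cnj (pauli u $ z $ w)) =
      (\<Sum>a\<in>UNIV. \<Sum>b\<in>UNIV. pauli (a, b) $ x $ y * cnj (pauli (a, b) $ z $ w))"
    by (simp add: sum.cartesian_product case_prod_unfold flip: UNIV_Times_UNIV)
  also have "\<dots> = (\<Sum>a\<in>UNIV. if a = x + y then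
      (if x + y = z + w then of_int (\<Sum>b\<in>UNIV. bit_sign b (y + w)) else 0) else 0)"
    by (intro sum.cong) (auto simp: pauli_nth_eq bit_sign_add_right)
  also have "\<dots> = (if x + y = z + w \<and> y + w = 0 then 2 ^ CARD('m) else 0)"
    by (simp add: sum_bit_sign)
  also have "x + y = z + w \<and> y + w = 0 \<longleftrightarrow> x = z \<and> y = w"
    by (metis add.commute add_0_right bit_vec_add_self bit_vec_add_self_left add_right_cancel)
  finally show ?thesis .
qed

section \<open>Tensor products of Pauli matrices\<close>

text \<open>Tensor products of Pauli matrices span all matrices, and twirling is linear.\<close>

lemma twirl_commutant_if_paulis:
  assumes "\<And>P :: ('m::finite label)^'k. twirl G (tensor_family (\<lambda>i. pauli (P $ i))) \<in> tensor_commutant"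
  shows "twirl G (X :: ((bit^'m)^'k::finite) cmat) \<in> tensor_commutant"
proof -
  define N :: complex where "N = (2 ^ CARD('m)) ^ CARD('k)"
  \<comment> \<open>\<open>c P\<close> is the trace inner product of the Pauli product with
    \<open>X\<close>, divided by the squared norm \<open>N\<close> of that product.\<close>
  define c where "c P = (\<Sum>z\<in>UNIV. \<Sum>w\<in>UNIV. X $ z $ w * (\<Prod>i\<in>UNIV. cnj (pauli (P $ i) $ (z $ i) $ (w $ i)))) / N"
    for P :: "('m label)^'k"
  have delta: "(\<Sum>P\<in>UNIV. \<Prod>i\<in>UNIV. pauli (P $ i) $ (x $ i) $ (y $ i) * cnj (pauli (P $ i) $ (z $ i) $ (w $ i))) =
      (if x = z \<and> y = w then N else 0)" for x y z w :: "(bit^'m)^'k"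
  proof -
    have "(\<Sum>P\<in>UNIV. \<Prod>i\<in>UNIV. pauli (P $ i) $ (x $ i) $ (y $ i) * cnj (pauli (P $ i) $ (z $ i) $ (w $ i))) =
        (\<Prod>i\<in>UNIV. \<Sum>u\<in>UNIV. pauli u $ (x $ i) $ (y $ i) * cnj (pauli u $ (z $ i) $ (w $ i)))"
      by (rule sum_vec_prod)
    also have "\<dots> = (\<Prod>i\<in>UNIV. if x $ i = z $ i \<and> y $ i = w $ i then 2 ^ CARD('m) else 0)"
      by (simp only: pauli_completeness)
    also have "\<dots> = (if x = z \<and> y = w then N else 0)"
      by (auto simp: N_def vec_eq_iff)
    finally show ?thesis .
  qed
  have "X $ x $ y = (\<Sum>P\<in>UNIV. c P * tensor_family (\<lambda>i. pauli (P $ i)) $ x $ y)" for x y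
  proof -
    have "(\<Sum>P\<in>UNIV. c P * tensor_family (\<lambda>i. pauli (P $ i)) $ x $ y) =
        (\<Sum>P\<in>UNIV. \<Sum>z\<in>UNIV. \<Sum>w\<in>UNIV. X $ z $ w / N *
          (\<Prod>i\<in>UNIV. pauli (P $ i) $ (x $ i) $ (y $ i) * cnj (pauli (P $ i) $ (z $ i) $ (w $ i))))"
      unfolding c_def tensor_family_nth sum_distrib_right sum_divide_distrib prod.distrib
      by (intro sum.cong refl) simp
    also have "\<dots> = (\<Sum>z\<in>UNIV. \<Sum>P\<in>UNIV. \<Sum>w\<in>UNIV. X $ z $ w / N *
          (\<Prod>i\<in>UNIV. pauli (P $ i) $ (x $ i) $ (y $ i) * cnj (pauli (P $ i) $ (z $ i) $ (w $ i))))"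
      by (rule sum.swap)
    also have "\<dots> = (\<Sum>z\<in>UNIV. \<Sum>w\<in>UNIV. \<Sum>P\<in>UNIV. X $ z $ w / N *
          (\<Prod>i\<in>UNIV. pauli (P $ i) $ (x $ i) $ (y $ i) * cnj (pauli (P $ i) $ (z $ i) $ (w $ i))))"
      by (intro sum.cong sum.swap refl)
    also have "\<dots> = (\<Sum>z\<in>UNIV. \<Sum>w\<in>UNIV. if y = w then (if x = z then X $ z $ w else 0) else 0)"
      unfolding sum_distrib_left[symmetric] delta by (intro sum.cong refl) (simp add: N_def)
    finally show ?thesis by simp
  qed
  then have "X = (\<Sum>P\<in>UNIV. cscale (c P) (tensor_family (\<lambda>i. pauli (P $ i))))"
    by (simp add: vec_eq_iff)
  then have "twirl G X = (\<Sum>P\<in>UNIV. cscale (c P) (twirl G (tensor_family (\<lambda>i. pauli (P $ i)))))"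
    by (simp only: twirl_sum twirl_cscale)
  then show ?thesis
    using assms by (simp add: tensor_commutant_sum tensor_commutant_cscale)
qed

lemma commutation_sign_sum: "(\<Prod>i\<in>S. commutation_sign w (f i)) = commutation_sign w (sum f S)"
  by (induction S rule: infinite_finite_induct) (auto simp: commutation_sign_add_right)

text \<open>Conjugation by \<open>pauli w\<close> multiplies the product by the commutation sign of
  \<open>w\<close> with the total label. If that label is nonzero, some \<open>w\<close> gives -1,
  and the invariant twirl equals its own negative.\<close>

lemma twirl_paulis_eq_0:
  fixes P :: "('m::finite label)^'k::finite"
  assumes G: "finite G" "\<And>g u. g \<in> G \<Longrightarrow> g ** pauli u \<in> G"
    and P: "(\<Sum>i\<in>UNIV. P $ i) \<noteq> 0"
  shows "twirl G (tensor_family (\<lambda>i. pauli (P $ i))) = 0"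
proof -
  let ?X = "tensor_family (\<lambda>i. pauli (P $ i))"
  obtain w where w: "commutation_sign w (\<Sum>i\<in>UNIV. P $ i) = - 1"
    using commutation_sign_nontrivial[OF P] .
  have "conjugate_by (tensor_power (pauli w)) ?X =
      cscale (\<Prod>i\<in>UNIV. of_int (commutation_sign w (P $ i))) ?X"
    by (simp add: conjugate_by_tensor_family conjugate_by_pauli tensor_family_cscale)
  also have "\<dots> = cscale (- 1) ?X"
    by (simp add: commutation_sign_sum w flip: of_int_prod)
  finally have conj: "conjugate_by (tensor_power (pauli w)) ?X = cscale (- 1) ?X" .
  have "twirl G ?X = twirl G (conjugate_by (tensor_power (pauli w)) ?X)"
    by (rule twirl_conjugate[symmetric, OF G pauli_unitary])
  also have "\<dots> = - twirl G ?X"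
    by (simp only: conj twirl_cscale minus_eq_cscale)
  finally have "twirl G ?X = - twirl G ?X" .
  then have "2 *\<^sub>R twirl G ?X = 0"
    by (simp only: scaleR_2 eq_neg_iff_add_eq_0)
  then show ?thesis by simp
qed

section \<open>Permutation matrices\<close>

definition permutation_matrix :: "('k \<Rightarrow> 'k) \<Rightarrow> ('n::finite^'k::finite) cmat" where
  "permutation_matrix \<sigma> = (\<chi> x y. \<Prod>i\<in>UNIV. of_bool (x $ i = y $ \<sigma> i))"

text \<open>In both products the permutation matrix leaves one intermediate index, and the entry is
  the product over \<open>i\<close> of \<open>V $ (x $ i) $ (y $ \<sigma> i)\<close>.\<close>

lemma permutation_matrix_commutant:
  fixes \<sigma> :: "'k::finite \<Rightarrow> 'k"
  assumes "bij \<sigma>"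
  shows "(permutation_matrix \<sigma> :: ('n::finite^'k) cmat) \<in> tensor_commutant"
proof -
  have "tensor_power V ** (permutation_matrix \<sigma> :: ('n^'k) cmat) = permutation_matrix \<sigma> ** tensor_power V"
    for V :: "'n cmat"
  proof -
    have "(tensor_power V ** permutation_matrix \<sigma>) $ x $ y = (permutation_matrix \<sigma> ** tensor_power V) $ x $ y" for x y
    proof -
      have "(tensor_power V ** permutation_matrix \<sigma>) $ x $ y =
          (\<Sum>z\<in>UNIV. \<Prod>i\<in>UNIV. V $ (x $ i) $ (z $ i) * of_bool (z $ i = y $ \<sigma> i))"
        by (simp add: matrix_mult_nth tensor_power_def tensor_family_nth permutation_matrix_def prod.distrib)
      also have "\<dots> = (\<Prod>i\<in>UNIV. \<Sum>j\<in>UNIV. V $ (x $ i) $ j * of_bool (j = y $ \<sigma> i))"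
        by (rule sum_vec_prod)
      also have "\<dots> = (\<Prod>i\<in>UNIV. V $ (x $ i) $ (y $ \<sigma> i))"
        by (simp add: of_bool_def if_distrib[of "(*) _"] cong: if_cong)
      finally have left: "(tensor_power V ** permutation_matrix \<sigma>) $ x $ y = (\<Prod>i\<in>UNIV. V $ (x $ i) $ (y $ \<sigma> i))" .
      \<comment> \<open>On this side the constraint fixes \<open>z $ \<sigma> i\<close> instead of
        \<open>z $ i\<close>; the inverse permutation restores a sum that splits into
        factors.\<close>
      have reindex: "(\<Prod>i\<in>UNIV. h i) = (\<Prod>i\<in>UNIV. h (inv_into UNIV \<sigma> i))" for h :: "'k \<Rightarrow> complex"
        by (rule prod.reindex_bij_betw[OF bij_imp_bij_inv[OF assms], symmetric])
      have inv: "\<sigma> (inv_into UNIV \<sigma> i) = i" for i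
        using assms by (simp add: bij_is_surj surj_f_inv_f)
      have "(permutation_matrix \<sigma> ** tensor_power V) $ x $ y =
          (\<Sum>z\<in>UNIV. (\<Prod>i\<in>UNIV. of_bool (x $ i = z $ \<sigma> i)) * (\<Prod>i\<in>UNIV. V $ (z $ i) $ (y $ i)))"
        by (simp add: matrix_mult_nth tensor_power_def tensor_family_nth permutation_matrix_def)
      also have "\<dots> = (\<Sum>z\<in>UNIV. \<Prod>i\<in>UNIV. of_bool (x $ inv_into UNIV \<sigma> i = z $ i) * V $ (z $ i) $ (y $ i))"
        unfolding prod.distrib by (subst reindex) (simp only: inv)
      also have "\<dots> = (\<Prod>i\<in>UNIV. \<Sum>j\<in>UNIV. of_bool (x $ inv_into UNIV \<sigma> i = j) * V $ j $ (y $ i))"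
        by (rule sum_vec_prod)
      also have "\<dots> = (\<Prod>i\<in>UNIV. V $ (x $ inv_into UNIV \<sigma> i) $ (y $ i))"
        by (simp add: of_bool_def if_distrib[of "\<lambda>c. c * _"] cong: if_cong)
      also have "\<dots> = (\<Prod>i\<in>UNIV. V $ (x $ i) $ (y $ \<sigma> i))"
        by (subst reindex[of "\<lambda>i. V $ (x $ i) $ (y $ \<sigma> i)"]) (simp only: inv)
      finally show ?thesis using left by simp
    qed
    then show ?thesis by (simp add: vec_eq_iff)
  qed
  then show ?thesis by (simp add: tensor_commutant_def)
qed

lemma tensor_commutant_one: "mat 1 \<in> tensor_commutant"
  by (simp add: tensor_commutant_def)

section \<open>Two tensor factors\<close>

definition tensor2 :: "'n::finite cmat \<Rightarrow> 'n cmat \<Rightarrow> ('n^2) cmat" where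
  "tensor2 A B = tensor_family (\<lambda>i. if i = 1 then A else B)"

lemma prod_UNIV_2: "(\<Prod>i\<in>UNIV. f (i :: 2)) = f 1 * (f 2 :: 'a::comm_monoid_mult)"
  unfolding UNIV_2 by simp

lemma prod_UNIV_3: "(\<Prod>i\<in>UNIV. f (i :: 3)) = f 1 * f 2 * (f 3 :: 'a::comm_monoid_mult)"
  unfolding UNIV_3 by (simp add: mult.assoc)

lemma tensor2_nth: "tensor2 A B $ x $ y = A $ (x $ 1) $ (y $ 1) * B $ (x $ 2) $ (y $ 2)"
  by (simp add: tensor2_def tensor_family_nth prod_UNIV_2)

lemma tensor_family_2: "tensor_family A = tensor2 (A 1) (A 2)"
  by (simp add: vec_eq_iff tensor2_nth tensor_family_nth prod_UNIV_2)

lemma conjugate_by_tensor2: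
  "conjugate_by (tensor_power g) (tensor2 A B) = tensor2 (conjugate_by g A) (conjugate_by g B)"
  unfolding tensor2_def conjugate_by_tensor_family
  by (intro arg_cong[of _ _ tensor_family] ext) simp

definition pauli2 :: "'m::finite label \<Rightarrow> ((bit^'m)^2) cmat" where
  "pauli2 u = tensor2 (pauli u) (adjoint_mat (pauli u))"

lemma pauli2_0: "pauli2 0 = mat 1"
  by (simp add: pauli2_def pauli_0 tensor2_def tensor_family_one)

text \<open>The adjoint exchanges the indices of the second factor, so completeness ties the row of
  each factor to the column of the other: the sum is a multiple of the swap.\<close>

lemma sum_pauli2_commutant: "(\<Sum>u\<in>UNIV. pauli2 (u :: 'm::finite label)) \<in> tensor_commutant"
proof -
  define \<sigma> :: "2 \<Rightarrow> 2" where "\<sigma> i = (if i = 1 then 2 else 1)" for i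
  have "bij \<sigma>"
    by (rule o_bij[of \<sigma>]) (auto simp: \<sigma>_def fun_eq_iff forall_2)
  moreover have "(\<Sum>u\<in>UNIV. pauli2 (u :: 'm label)) = cscale (2 ^ CARD('m)) (permutation_matrix \<sigma>)"
    by (intro matrix_eqI, simp add: pauli2_def tensor2_nth pauli_completeness permutation_matrix_def prod_UNIV_2 \<sigma>_def,
      auto simp: of_bool_def)
  ultimately show ?thesis
    by (simp add: permutation_matrix_commutant tensor_commutant_cscale)
qed

section \<open>Three tensor factors\<close>

definition tensor3 :: "'n::finite cmat \<Rightarrow> 'n cmat \<Rightarrow> 'n cmat \<Rightarrow> ('n^3) cmat" where
  "tensor3 A B C = tensor_family (\<lambda>i. if i = 1 then A else if i = 2 then B else C)"

lemma tensor3_nth: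
  "tensor3 A B C $ x $ y = A $ (x $ 1) $ (y $ 1) * B $ (x $ 2) $ (y $ 2) * C $ (x $ 3) $ (y $ 3)"
  by (simp add: tensor3_def tensor_family_nth prod_UNIV_3)

lemma tensor_family_3: "tensor_family A = tensor3 (A 1) (A 2) (A 3)"
  by (simp add: vec_eq_iff tensor3_nth tensor_family_nth prod_UNIV_3)

lemma tensor3_cscale:
  "tensor3 (cscale a A) B C = cscale a (tensor3 A B C)"
  "tensor3 A (cscale a B) C = cscale a (tensor3 A B C)"
  "tensor3 A B (cscale a C) = cscale a (tensor3 A B C)"
  by (simp_all add: vec_eq_iff tensor3_nth)

lemma conjugate_by_tensor3:
  "conjugate_by (tensor_power g) (tensor3 A B C) =
    tensor3 (conjugate_by g A) (conjugate_by g B) (conjugate_by g C)"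
  unfolding tensor3_def conjugate_by_tensor_family
  by (intro arg_cong[of _ _ tensor_family] ext) simp

definition pauli3 :: "'m::finite label \<times> 'm label \<Rightarrow> ((bit^'m)^3) cmat" where
  "pauli3 p = tensor3 (pauli (fst p)) (pauli (snd p)) (adjoint_mat (pauli (fst p) ** pauli (snd p)))"

definition commuting_class :: "('m::finite label \<times> 'm label) set" where
  "commuting_class = {(u, v). u \<noteq> 0 \<and> v \<noteq> 0 \<and> u \<noteq> v \<and> commutation_sign u v = 1}"

text \<open>The sign -1 already excludes zero and equal labels, so these are exactly the
  non-edges.\<close>

definition anticommuting_class :: "('m::finite label \<times> 'm label) set" where
  "anticommuting_class = {(u, v). commutation_sign u v = - 1}"

definition perm3 :: "3 \<Rightarrow> 3 \<Rightarrow> 3 \<Rightarrow> 3 \<Rightarrow> 3" where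
  "perm3 a b c i = (if i = 1 then a else if i = 2 then b else c)"

lemma permutation_matrix_perm3_nth:
  "permutation_matrix (perm3 a b c) $ x $ y = of_bool (x $ 1 = y $ a \<and> x $ 2 = y $ b \<and> x $ 3 = y $ c)"
  by (simp add: permutation_matrix_def prod_UNIV_3 perm3_def)

lemma perm3_commutant:
  assumes "a \<noteq> b" "a \<noteq> c" "b \<noteq> c"
  shows "permutation_matrix (perm3 a b c) \<in> tensor_commutant"
proof (rule permutation_matrix_commutant)
  have "inj (perm3 a b c)"
    using assms by (auto simp: inj_def perm3_def forall_3)
  then show "bij (perm3 a b c)"
    by (simp add: bij_def finite_UNIV_inj_surj)
qed

lemma pauli3_0_commutant: "pauli3 (0, 0 :: 'm::finite label) \<in> tensor_commutant"
proof -
  have "pauli3 (0, 0 :: 'm label) = mat 1"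
    by (simp add: pauli3_def pauli_0 tensor3_def cong: if_cong) (simp flip: tensor_family_one)
  then show ?thesis by (simp add: tensor_commutant_one)
qed

text \<open>In each family one factor is the identity and the other two carry a Pauli matrix and its
  adjoint, so completeness yields a multiple of a transposition.\<close>

lemma sum_pauli3_axes_commutant:
  "(\<Sum>v\<in>UNIV. pauli3 (0, v :: 'm::finite label)) \<in> tensor_commutant"
  "(\<Sum>u\<in>UNIV. pauli3 (u :: 'm::finite label, 0)) \<in> tensor_commutant"
  "(\<Sum>u\<in>UNIV. pauli3 (u :: 'm::finite label, u)) \<in> tensor_commutant"
proof -
  have one: "(mat 1 :: (bit^'m) cmat) $ x $ y = of_bool (x = y)" for x y
    by (simp add: mat_def)
  have move: "a * of_bool b * c = of_bool b * (a * c)" for a c :: complex and b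
    by simp
  have "(\<Sum>v\<in>UNIV. pauli3 (0, v :: 'm label)) = cscale (2 ^ CARD('m)) (permutation_matrix (perm3 1 3 2))"
    by (intro matrix_eqI, unfold permutation_matrix_perm3_nth sum_component cscale_nth,
      simp add: pauli3_def pauli_0 tensor3_nth one mult.assoc pauli_completeness flip: sum_distrib_left,
      auto simp: of_bool_def)
  then show "(\<Sum>v\<in>UNIV. pauli3 (0, v :: 'm label)) \<in> tensor_commutant"
    by (simp add: perm3_commutant tensor_commutant_cscale)
  have "(\<Sum>u\<in>UNIV. pauli3 (u :: 'm label, 0)) = cscale (2 ^ CARD('m)) (permutation_matrix (perm3 3 2 1))"
    by (intro matrix_eqI, unfold permutation_matrix_perm3_nth sum_component cscale_nth,
      simp add: pauli3_def pauli_0 tensor3_nth one move pauli_completeness flip: sum_distrib_left,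
      auto simp: of_bool_def)
  then show "(\<Sum>u\<in>UNIV. pauli3 (u :: 'm label, 0)) \<in> tensor_commutant"
    by (simp add: perm3_commutant tensor_commutant_cscale)
  \<comment> \<open>\<open>pauli u\<close> squares to a sign times the identity, and the same sign
    turns it into its adjoint; the sign moves from the third factor to the second.\<close>
  have "pauli3 (u, u) = tensor3 (pauli u) (adjoint_mat (pauli u)) (mat 1)" for u :: "'m label"
    by (simp add: pauli3_def pauli_mult pauli_adjoint pauli_0 tensor3_cscale)
  then have "(\<Sum>u\<in>UNIV. pauli3 (u :: 'm label, u)) = cscale (2 ^ CARD('m)) (permutation_matrix (perm3 2 1 3))"
    by (intro matrix_eqI, unfold permutation_matrix_perm3_nth sum_component cscale_nth,
      simp add: tensor3_nth one pauli_completeness flip: sum_distrib_right,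
      auto simp: of_bool_def)
  then show "(\<Sum>u\<in>UNIV. pauli3 (u :: 'm label, u)) \<in> tensor_commutant"
    by (simp add: perm3_commutant tensor_commutant_cscale)
qed

text \<open>Expanding the product over an intermediate index \<open>t\<close> separates
  \<open>u\<close> from \<open>v\<close>. Completeness applies to each, and \<open>t\<close> links
  the results through \<open>y = t\<close> and \<open>x' = t\<close>.\<close>

lemma sum_pauli_pairs:
  fixes x y x' y' z w :: "bit^'m::finite"
  shows "(\<Sum>u\<in>UNIV. \<Sum>v\<in>UNIV. pauli u $ x $ y * pauli v $ x' $ y' * cnj ((pauli u ** pauli v) $ z $ w)) =
    (if x = z \<and> y = x' \<and> y' = w then (2 ^ CARD('m))\<^sup>2 else 0)"
proof -
  have "(\<Sum>u\<in>UNIV. \<Sum>v\<in>UNIV. pauli u $ x $ y * pauli v $ x' $ y' * cnj ((pauli u ** pauli v) $ z $ w)) =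
      (\<Sum>u\<in>UNIV. \<Sum>v\<in>UNIV. \<Sum>t\<in>UNIV. (pauli u $ x $ y * cnj (pauli u $ z $ t)) *
        (pauli v $ x' $ y' * cnj (pauli v $ t $ w)))"
    by (simp add: matrix_mult_nth sum_distrib_left mult_ac)
  also have "\<dots> = (\<Sum>u\<in>UNIV. \<Sum>t\<in>UNIV. \<Sum>v\<in>UNIV. (pauli u $ x $ y * cnj (pauli u $ z $ t)) *
        (pauli v $ x' $ y' * cnj (pauli v $ t $ w)))"
    by (intro sum.cong sum.swap refl)
  also have "\<dots> = (\<Sum>t\<in>UNIV. \<Sum>u\<in>UNIV. \<Sum>v\<in>UNIV. (pauli u $ x $ y * cnj (pauli u $ z $ t)) *
        (pauli v $ x' $ y' * cnj (pauli v $ t $ w)))"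
    by (rule sum.swap)
  also have "\<dots> = (\<Sum>t\<in>UNIV. (if x = z \<and> y = t then 2 ^ CARD('m) else 0) *
      (if x' = t \<and> y' = w then 2 ^ CARD('m) else 0))"
    by (simp only: sum_product[symmetric] pauli_completeness)
  also have "\<dots> = (\<Sum>t\<in>UNIV. if y = t then (if x = z \<and> y = x' \<and> y' = w then (2 ^ CARD('m))\<^sup>2 else 0) else 0)"
    by (intro sum.cong) (auto simp: power2_eq_square)
  finally show ?thesis by simp
qed

lemma sum_pauli3_commutant: "(\<Sum>p\<in>UNIV. pauli3 (p :: 'm::finite label \<times> 'm label)) \<in> tensor_commutant"
proof -
  have "(\<Sum>p\<in>UNIV. pauli3 (p :: 'm label \<times> 'm label)) $ x $ y =
      cscale ((2 ^ CARD('m))\<^sup>2) (permutation_matrix (perm3 3 1 2)) $ x $ y" for x y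
  proof -
    have "(\<Sum>p\<in>UNIV. pauli3 (p :: 'm label \<times> 'm label)) $ x $ y =
        (\<Sum>u\<in>(UNIV :: 'm label set). \<Sum>v\<in>(UNIV :: 'm label set). pauli3 (u, v) $ x $ y)"
      by (simp add: sum.cartesian_product case_prod_unfold flip: UNIV_Times_UNIV)
    also have "\<dots> = (if x $ 1 = y $ 3 \<and> y $ 1 = x $ 2 \<and> y $ 2 = x $ 3 then (2 ^ CARD('m))\<^sup>2 else 0)"
      by (simp add: pauli3_def tensor3_nth sum_pauli_pairs)
    finally show ?thesis
      by (auto simp: permutation_matrix_perm3_nth)
  qed
  then have "(\<Sum>p\<in>UNIV. pauli3 (p :: 'm label \<times> 'm label)) =
      cscale ((2 ^ CARD('m))\<^sup>2) (permutation_matrix (perm3 3 1 2))"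
    by (simp add: vec_eq_iff)
  then show ?thesis
    by (simp add: perm3_commutant tensor_commutant_cscale)
qed

lemma sum_signed_pauli3_commutant:
  "(\<Sum>p\<in>UNIV. cscale (of_int (commutation_sign (fst p) (snd p))) (pauli3 (p :: 'm::finite label \<times> 'm label)))
    \<in> tensor_commutant"
proof -
  have "(\<Sum>p\<in>UNIV. cscale (of_int (commutation_sign (fst p) (snd p))) (pauli3 (p :: 'm label \<times> 'm label))) $ x $ y =
      cscale ((2 ^ CARD('m))\<^sup>2) (permutation_matrix (perm3 2 3 1)) $ x $ y" for x y
  proof -
    \<comment> \<open>The commutation sign reverses the product in the third factor. The unsigned
      computation then applies with the first two factors exchanged and gives the inverse
      3-cycle.\<close>
    have swap: "of_int (commutation_sign u v) * pauli3 (u, v) $ x $ y =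
        pauli v $ (x $ 2) $ (y $ 2) * pauli u $ (x $ 1) $ (y $ 1) * cnj ((pauli v ** pauli u) $ (y $ 3) $ (x $ 3))"
      for u v :: "'m label"
      by (subst pauli_commute[of v u])
        (simp add: pauli3_def tensor3_nth commutation_sign_commute mult_ac)
    have "(\<Sum>p\<in>UNIV. cscale (of_int (commutation_sign (fst p) (snd p))) (pauli3 (p :: 'm label \<times> 'm label))) $ x $ y =
        (\<Sum>u\<in>(UNIV :: 'm label set). \<Sum>v\<in>(UNIV :: 'm label set). of_int (commutation_sign u v) * pauli3 (u, v) $ x $ y)"
      by (simp add: sum.cartesian_product case_prod_unfold flip: UNIV_Times_UNIV)
    also have "\<dots> = (\<Sum>v\<in>UNIV. \<Sum>u\<in>UNIV. pauli v $ (x $ 2) $ (y $ 2) * pauli u $ (x $ 1) $ (y $ 1) *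
        cnj ((pauli v ** pauli u) $ (y $ 3) $ (x $ 3)))"
      unfolding swap by (rule sum.swap)
    also have "\<dots> = (if x $ 2 = y $ 3 \<and> y $ 2 = x $ 1 \<and> y $ 1 = x $ 3 then (2 ^ CARD('m))\<^sup>2 else 0)"
      by (rule sum_pauli_pairs)
    finally show ?thesis
      by (auto simp: permutation_matrix_perm3_nth)
  qed
  then have "(\<Sum>p\<in>UNIV. cscale (of_int (commutation_sign (fst p) (snd p))) (pauli3 (p :: 'm label \<times> 'm label))) =
      cscale ((2 ^ CARD('m))\<^sup>2) (permutation_matrix (perm3 2 3 1))"
    by (simp add: vec_eq_iff)
  then show ?thesis
    by (simp add: perm3_commutant tensor_commutant_cscale)
qed

lemma sum_pauli3_sign_commutant:
  assumes "\<epsilon> = 1 \<or> \<epsilon> = - 1"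
  shows "(\<Sum>p | commutation_sign (fst p) (snd p) = \<epsilon>. pauli3 (p :: 'm::finite label \<times> 'm label)) \<in> tensor_commutant"
proof -
  let ?c = "\<lambda>p :: 'm label \<times> 'm label. commutation_sign (fst p) (snd p)"
  have "(\<Sum>p | ?c p = \<epsilon>. pauli3 p) = (\<Sum>p\<in>UNIV. if ?c p = \<epsilon> then pauli3 p else 0)"
    by (simp add: sum.If_cases)
  \<comment> \<open>For a sign \<open>s\<close>, the indicator of \<open>s = \<epsilon>\<close> is
    \<open>(1 + \<epsilon> * s) / 2\<close>.\<close>
  also have "\<dots> = (\<Sum>p\<in>UNIV. cscale (1 / 2) (pauli3 p + cscale (of_int \<epsilon>) (cscale (of_int (?c p)) (pauli3 p))))"
  proof (rule sum.cong[OF refl])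
    fix p
    have "?c p = 1 \<or> ?c p = - 1" by (rule commutation_sign_cases)
    then show "(if ?c p = \<epsilon> then pauli3 p else 0) =
        cscale (1 / 2) (pauli3 p + cscale (of_int \<epsilon>) (cscale (of_int (?c p)) (pauli3 p)))"
      using assms by (auto simp: vec_eq_iff)
  qed
  also have "\<dots> = cscale (1 / 2) ((\<Sum>p\<in>UNIV. pauli3 p) +
      cscale (of_int \<epsilon>) (\<Sum>p\<in>UNIV. cscale (of_int (?c p)) (pauli3 p)))"
    by (simp only: cscale_sum sum.distrib cscale_add)
  also have "\<dots> \<in> tensor_commutant"
    by (intro tensor_commutant_cscale tensor_commutant_add sum_pauli3_commutant sum_signed_pauli3_commutant)
  finally show ?thesis .
qed

lemma sum_pauli3_anticommuting: "(\<Sum>p\<in>anticommuting_class. pauli3 p) \<in> tensor_commutant"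
  using sum_pauli3_sign_commutant[of "- 1"]
  by (simp add: anticommuting_class_def case_prod_unfold)

lemma sum_pauli3_degenerate:
  fixes S :: "'m::finite label set"
  assumes "S = - {0}"
  shows "(\<Sum>p\<in>Pair 0 ` S. pauli3 p) \<in> tensor_commutant"
    and "(\<Sum>p\<in>(\<lambda>u. (u, 0)) ` S. pauli3 p) \<in> tensor_commutant"
    and "(\<Sum>p\<in>(\<lambda>u. (u, u)) ` S. pauli3 p) \<in> tensor_commutant"
proof -
  have image: "(\<Sum>p\<in>f ` S. pauli3 p) \<in> tensor_commutant"
    if "inj f" "f 0 = (0, 0)" "(\<Sum>u\<in>UNIV. pauli3 (f u)) \<in> tensor_commutant"
    for f :: "'m label \<Rightarrow> 'm label \<times> 'm label"
  proof -
    have "(\<Sum>p\<in>f ` S. pauli3 p) = (\<Sum>u\<in>S. pauli3 (f u))"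
      using that(1) by (simp add: sum.reindex inj_on_subset)
    also have "\<dots> = (\<Sum>u\<in>UNIV. pauli3 (f u)) - pauli3 (0, 0)"
      using assms that(2) by (simp add: sum_diff1 Compl_eq_Diff_UNIV)
    also have "\<dots> \<in> tensor_commutant"
      by (intro tensor_commutant_diff that pauli3_0_commutant)
    finally show ?thesis .
  qed
  show "(\<Sum>p\<in>Pair 0 ` S. pauli3 p) \<in> tensor_commutant"
    and "(\<Sum>p\<in>(\<lambda>u. (u, 0)) ` S. pauli3 p) \<in> tensor_commutant"
    and "(\<Sum>p\<in>(\<lambda>u. (u, u)) ` S. pauli3 p) \<in> tensor_commutant"
    by (intro image sum_pauli3_axes_commutant; simp add: inj_def)+
qed

lemma sum_pauli3_commuting:
  "(\<Sum>p\<in>commuting_class. pauli3 (p :: 'm::finite label \<times> 'm label)) \<in> tensor_commutant"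
proof -
  define S :: "'m label set" where "S = - {0}"
  let ?A = "Pair 0 ` S" and ?B = "(\<lambda>u. (u, 0)) ` S" and ?C = "(\<lambda>u. (u, u)) ` S"
  let ?K = "{p :: 'm label \<times> 'm label. commutation_sign (fst p) (snd p) = 1}"
  \<comment> \<open>A pair of sign 1 fails to be an edge exactly when it is the origin or
    degenerate; with \<open>S\<close> free of 0 the four removed sets are disjoint.\<close>
  have split: "commuting_class = ?K - ({(0, 0)} \<union> ?A \<union> ?B \<union> ?C)"
    by (auto simp: commuting_class_def S_def)
  have "{(0, 0)} \<union> ?A \<union> ?B \<union> ?C \<subseteq> ?K"
    by auto
  then have "(\<Sum>p\<in>commuting_class. pauli3 p) =
      (\<Sum>p\<in>?K. pauli3 p) - (\<Sum>p\<in>{(0, 0)} \<union> ?A \<union> ?B \<union> ?C. pauli3 p)"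
    unfolding split by (intro sum_diff) simp_all
  also have "(\<Sum>p\<in>{(0, 0)} \<union> ?A \<union> ?B \<union> ?C. pauli3 p) =
      pauli3 (0, 0) + (\<Sum>p\<in>?A. pauli3 p) + (\<Sum>p\<in>?B. pauli3 p) + (\<Sum>p\<in>?C. pauli3 p)"
    by (subst sum.union_disjoint, simp, simp, force simp: S_def)+ simp
  also have "(\<Sum>p\<in>?K. pauli3 p) - \<dots> \<in> tensor_commutant"
    by (intro tensor_commutant_diff tensor_commutant_add pauli3_0_commutant
        sum_pauli3_degenerate[OF S_def] sum_pauli3_sign_commutant) simp
  finally show ?thesis .
qed

section \<open>Unordered and ordered transitivity\<close>

lemma sum_commutation_sign:
  "(\<Sum>w\<in>UNIV. commutation_sign (u :: 'm::finite label) w) = (if u = 0 then 4 ^ CARD('m) else 0)"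
proof (cases "u = 0")
  case True
  then show ?thesis by (simp add: power_mult_distrib[symmetric])
next
  case False
  then obtain w where "commutation_sign w u = - 1"
    using commutation_sign_nontrivial by blast
  then have "commutation_sign u w \<noteq> 1" by (simp add: commutation_sign_commute)
  then show ?thesis
    using False by (simp add: sum_character_eq_0[OF commutation_sign_add_right])
qed

lemma card_sign_eq:
  fixes u :: "'m::finite label"
  assumes "u \<noteq> 0" "\<epsilon> = 1 \<or> \<epsilon> = - 1"
  shows "2 * int (card {w. commutation_sign u w = \<epsilon>}) = 4 ^ CARD('m)"
proof -
  have "2 * int (card {w. commutation_sign u w = \<epsilon>}) = (\<Sum>w\<in>UNIV. if commutation_sign u w = \<epsilon> then 2 else 0)"
    by (simp add: sum.If_cases)
  \<comment> \<open>Twice the indicator is \<open>1 + \<epsilon> * commutation_sign u w\<close>; the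
    constant is written as the character of label 0 so that one summation rule evaluates both
    terms.\<close>
  also have "\<dots> = (\<Sum>w\<in>UNIV. commutation_sign 0 w + \<epsilon> * commutation_sign u w)"
  proof (rule sum.cong[OF refl])
    show "(if commutation_sign u w = \<epsilon> then 2 else 0) = commutation_sign 0 w + \<epsilon> * commutation_sign u w" for w
      using assms(2) commutation_sign_cases[of u w] by auto
  qed
  also have "\<dots> = 4 ^ CARD('m)"
    using assms(1) by (simp only: sum.distrib sum_commutation_sign flip: sum_distrib_left) simp
  finally show ?thesis .
qed

lemma card_sign_sign_eq:
  fixes u v :: "'m::finite label"
  assumes "u \<noteq> 0" "v \<noteq> 0" "u \<noteq> v" and e: "\<epsilon> = 1 \<or> \<epsilon> = - 1" and d: "\<delta> = 1 \<or> \<delta> = - 1"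
  shows "4 * int (card {w. commutation_sign u w = \<epsilon> \<and> commutation_sign v w = \<delta>}) = 4 ^ CARD('m)"
proof -
  have "4 * int (card {w. commutation_sign u w = \<epsilon> \<and> commutation_sign v w = \<delta>}) =
      (\<Sum>w\<in>UNIV. if commutation_sign u w = \<epsilon> \<and> commutation_sign v w = \<delta> then 4 else 0)"
    by (simp add: sum.If_cases)
  \<comment> \<open>Four times the indicator is a product of two such factors. The product of both
    signs is the character of \<open>u + v\<close>, a nonzero label, so only the constant survives
    the summation.\<close>
  also have "\<dots> = (\<Sum>w\<in>UNIV. commutation_sign 0 w + \<epsilon> * commutation_sign u w +
      \<delta> * commutation_sign v w + \<epsilon> * \<delta> * commutation_sign (u + v) w)"
  proof (rule sum.cong[OF refl])
    show "(if commutation_sign u w = \<epsilon> \<and> commutation_sign v w = \<delta> then 4 else 0) =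
        commutation_sign 0 w + \<epsilon> * commutation_sign u w +
        \<delta> * commutation_sign v w + \<epsilon> * \<delta> * commutation_sign (u + v) w" for w
      using e d commutation_sign_cases[of u w] commutation_sign_cases[of v w]
      by (auto simp: commutation_sign_add_left)
  qed
  also have "\<dots> = 4 ^ CARD('m)"
    using assms(1-3) by (simp only: sum.distrib sum_commutation_sign flip: sum_distrib_left) simp
  finally show ?thesis .
qed

text \<open>Each sign is odd and of absolute value 1. Applied to common neighbours, this bounds an
  entry of the square of an orientation and fixes its parity.\<close>

lemma sum_signs_bound:
  fixes f :: "'a \<Rightarrow> int"
  assumes "\<And>x. x \<in> S \<Longrightarrow> f x = 1 \<or> f x = - 1"
  shows "\<bar>sum f S\<bar> \<le> int (card S)" "even (sum f S - int (card S))"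
  using assms
proof (induction S rule: infinite_finite_induct)
  case (insert x S)
  {
    case 1
    with insert show ?case by fastforce
  next
    case 2
    with insert show ?case by fastforce
  }
qed auto

text \<open>This abstracts the image of \<open>G\<close> in the symplectic group of the label space
  over the field with two elements; the arguments inside the locale are purely
  combinatorial.\<close>

locale symplectic_maps =
  fixes H :: "('m::finite label \<Rightarrow> 'm label) set"
  assumes comp: "\<And>\<pi> \<rho>. \<pi> \<in> H \<Longrightarrow> \<rho> \<in> H \<Longrightarrow> \<pi> \<circ> \<rho> \<in> H"
    and left_inverse: "\<And>\<pi>. \<pi> \<in> H \<Longrightarrow> \<exists>\<rho>\<in>H. \<rho> \<circ> \<pi> = id"
    and additive: "\<And>\<pi> u v. \<pi> \<in> H \<Longrightarrow> \<pi> (u + v) = \<pi> u + \<pi> v"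
    and sign_invariant: "\<And>\<pi> u v. \<pi> \<in> H \<Longrightarrow> commutation_sign (\<pi> u) (\<pi> v) = commutation_sign u v"
    and transitive: "\<And>u v. u \<noteq> 0 \<Longrightarrow> v \<noteq> 0 \<Longrightarrow> \<exists>\<pi>\<in>H. \<pi> u = v"
begin

definition unordered_transitive :: "('m label \<times> 'm label) set \<Rightarrow> bool" where
  "unordered_transitive C \<longleftrightarrow> (\<forall>(u, v)\<in>C. \<forall>(u', v')\<in>C. \<exists>\<pi>\<in>H. \<pi> u = u' \<and> \<pi> v = v' \<or> \<pi> u = v' \<and> \<pi> v = u')"

definition ordered_transitive :: "('m label \<times> 'm label) set \<Rightarrow> bool" where
  "ordered_transitive C \<longleftrightarrow> (\<forall>(u, v)\<in>C. \<forall>(u', v')\<in>C. \<exists>\<pi>\<in>H. \<pi> u = u' \<and> \<pi> v = v')"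

lemma bij: "\<pi> \<in> H \<Longrightarrow> bij \<pi>"
proof -
  assume "\<pi> \<in> H"
  then obtain \<rho> where "\<rho> \<circ> \<pi> = id" using left_inverse by blast
  then have "inj \<pi>" by (metis inj_on_id inj_on_imageI2)
  then show "bij \<pi>" by (simp add: bij_def finite_UNIV_inj_surj)
qed

lemma map_0: "\<pi> \<in> H \<Longrightarrow> \<pi> 0 = 0"
  using additive[of \<pi> 0 0] by simp

lemma map_eq_0_iff: "\<pi> \<in> H \<Longrightarrow> \<pi> u = 0 \<longleftrightarrow> u = 0"
  using map_0[of \<pi>] bij[of \<pi>] by (metis bij_pointE)

lemma map_eq_iff: "\<pi> \<in> H \<Longrightarrow> \<pi> u = \<pi> v \<longleftrightarrow> u = v"
  using bij[of \<pi>] by (metis bij_pointE)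

definition pair_class :: "('m label \<times> 'm label) set \<Rightarrow> bool" where
  "pair_class C \<longleftrightarrow> (\<forall>u v. (u, v) \<in> C \<longrightarrow> (v, u) \<in> C) \<and> (\<forall>\<pi>\<in>H. \<forall>u v. (\<pi> u, \<pi> v) \<in> C \<longleftrightarrow> (u, v) \<in> C)"

lemma pair_class_commuting: "pair_class commuting_class"
  by (auto simp: pair_class_def commuting_class_def commutation_sign_commute
      map_eq_0_iff map_eq_iff sign_invariant)

lemma pair_class_anticommuting: "pair_class anticommuting_class"
  by (auto simp: pair_class_def anticommuting_class_def commutation_sign_commute sign_invariant)

text \<open>An invariant choice of direction for every pair in \<open>C\<close>, encoded as a skew
  adjacency matrix so that directed paths are counted by matrix products.\<close>

definition orientation :: "('m label \<times> 'm label) set \<Rightarrow> ('m label \<Rightarrow> 'm label \<Rightarrow> int) \<Rightarrow> bool" where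
  "orientation C A \<longleftrightarrow> (\<forall>u v. A v u = - A u v) \<and> (\<forall>\<pi>\<in>H. \<forall>u v. A (\<pi> u) (\<pi> v) = A u v) \<and>
    (\<forall>u v. (u, v) \<in> C \<longrightarrow> A u v = 1 \<or> A u v = - 1) \<and> (\<forall>u v. (u, v) \<notin> C \<longrightarrow> A u v = 0)"

text \<open>If every pair in \<open>C\<close> could be reversed by \<open>H\<close>, a reversal
  would repair any match in the wrong order, and ordered transitivity would follow. So some pair is
  never reversed, and its orbit contains exactly one ordering of each pair in
  \<open>C\<close>.\<close>

lemma orientation_exists:
  assumes C: "pair_class C" and un: "unordered_transitive C" and nord: "\<not> ordered_transitive C"
  obtains A where "orientation C A"
proof -
  have "\<exists>u v. (u, v) \<in> C \<and> \<not> (\<exists>\<pi>\<in>H. \<pi> u = v \<and> \<pi> v = u)"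
  proof (rule ccontr)
    assume "\<not> ?thesis"
    then have flip: "\<exists>\<rho>\<in>H. \<rho> u = v \<and> \<rho> v = u" if "(u, v) \<in> C" for u v
      using that by blast
    have "\<exists>\<pi>\<in>H. \<pi> u = u' \<and> \<pi> v = v'" if C': "(u, v) \<in> C" "(u', v') \<in> C" for u v u' v'
    proof -
      obtain \<pi> where \<pi>: "\<pi> \<in> H" "\<pi> u = u' \<and> \<pi> v = v' \<or> \<pi> u = v' \<and> \<pi> v = u'"
        using un C' unfolding unordered_transitive_def by fast
      obtain \<rho> where \<rho>: "\<rho> \<in> H" "\<rho> u' = v'" "\<rho> v' = u'"
        using flip[OF C'(2)] by blast
      have "\<rho> \<circ> \<pi> \<in> H" using comp \<pi> \<rho> by blast
      then show ?thesis using \<pi> \<rho> by (metis comp_apply)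
    qed
    then show False using nord unfolding ordered_transitive_def by blast
  qed
  then obtain u0 v0 where u0: "(u0, v0) \<in> C" and noflip: "\<And>\<pi>. \<pi> \<in> H \<Longrightarrow> \<pi> u0 = v0 \<Longrightarrow> \<pi> v0 \<noteq> u0"
    by blast
  define orb where "orb u v \<longleftrightarrow> (\<exists>\<pi>\<in>H. \<pi> u0 = u \<and> \<pi> v0 = v)" for u v
  define A :: "'m label \<Rightarrow> 'm label \<Rightarrow> int" where "A u v = (if orb u v then 1 else if orb v u then - 1 else 0)" for u v
  have orb_map: "orb (\<pi> u) (\<pi> v)" if "\<pi> \<in> H" "orb u v" for \<pi> u v
    using that comp unfolding orb_def by (metis comp_apply)
  have orb_iff: "orb (\<pi> u) (\<pi> v) \<longleftrightarrow> orb u v" if \<pi>: "\<pi> \<in> H" for \<pi> u v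
  proof
    assume o: "orb (\<pi> u) (\<pi> v)"
    obtain \<rho> where "\<rho> \<in> H" "\<rho> \<circ> \<pi> = id" using left_inverse[OF \<pi>] by blast
    then show "orb u v" using orb_map[OF _ o] by (metis comp_apply id_apply)
  qed (use \<pi> orb_map in blast)
  have asym: "\<not> orb v u" if "orb u v" for u v
  proof
    assume "orb v u"
    obtain \<pi> where "\<pi> \<in> H" "\<pi> u0 = u" "\<pi> v0 = v" using \<open>orb u v\<close> unfolding orb_def by blast
    then have "orb v0 u0" using \<open>orb v u\<close> orb_iff by metis
    then show False using noflip unfolding orb_def by blast
  qed
  have orb_C: "(u, v) \<in> C" if "orb u v" for u v
    using that u0 C unfolding orb_def pair_class_def by blast
  have total: "orb u v \<or> orb v u" if "(u, v) \<in> C" for u v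
    using that u0 un unfolding orb_def unordered_transitive_def by fast
  have sym: "(v, u) \<in> C" if "(u, v) \<in> C" for u v
    using that C unfolding pair_class_def by blast
  have "orientation C A"
    unfolding orientation_def
  proof (intro conjI allI ballI impI)
    show "A v u = - A u v" for u v
      unfolding A_def using asym[of u v] by simp
    show "A (\<pi> u) (\<pi> v) = A u v" if "\<pi> \<in> H" for \<pi> u v
      unfolding A_def using orb_iff[OF that] by simp
    show "A u v = 1 \<or> A u v = - 1" if "(u, v) \<in> C" for u v
      unfolding A_def using total[OF that] by auto
    show "A u v = 0" if "(u, v) \<notin> C" for u v
      unfolding A_def using that orb_C sym by metis
  qed
  then show ?thesis using that by blast
qed

section \<open>Row sums and the square of an invariant orientation\<close>

context
  fixes C :: "('m label \<times> 'm label) set" and A :: "'m label \<Rightarrow> 'm label \<Rightarrow> int"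
  assumes A: "orientation C A" and C_nonzero: "\<forall>u v. (u, v) \<in> C \<longrightarrow> u \<noteq> 0 \<and> v \<noteq> 0"
begin

lemma orientation_antisym: "A v u = - A u v"
  using A unfolding orientation_def by blast

lemma orientation_map: "\<pi> \<in> H \<Longrightarrow> A (\<pi> u) (\<pi> v) = A u v"
  using A unfolding orientation_def by blast

lemma orientation_sign: "(u, v) \<in> C \<Longrightarrow> A u v = 1 \<or> A u v = - 1"
  using A unfolding orientation_def by blast

lemma orientation_eq_0: "(u, v) \<notin> C \<Longrightarrow> A u v = 0"
  using A unfolding orientation_def by blast

text \<open>Transitivity makes the row sums at nonzero labels equal, row 0 vanishes, and the entries
  of an antisymmetric matrix add up to 0.\<close>

lemma orientation_row_sum: "(\<Sum>v\<in>UNIV. A u v) = 0"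
proof (cases "u = 0")
  case True
  then show ?thesis using orientation_eq_0 C_nonzero by (intro sum.neutral) blast
next
  case False
  define R where "R u = (\<Sum>v\<in>UNIV. A u v)" for u
  have "R (\<pi> w) = R w" if "\<pi> \<in> H" for \<pi> w
    unfolding R_def using bij[OF that] orientation_map[OF that]
    by (subst sum.reindex_bij_betw[of \<pi>, symmetric]) auto
  then have const: "R v = R u" if "v \<noteq> 0" for v
    using transitive[OF False that] by metis
  have "(\<Sum>u\<in>UNIV. R u) = (\<Sum>v\<in>UNIV. \<Sum>u\<in>UNIV. A u v)"
    unfolding R_def by (rule sum.swap)
  also have "\<dots> = - (\<Sum>u\<in>UNIV. R u)"
    unfolding R_def sum_negf[symmetric] by (intro sum.cong refl orientation_antisym)
  finally have "(\<Sum>v\<in>UNIV. R v) = 0" by simp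
  moreover have "R 0 = 0"
    unfolding R_def using orientation_eq_0 C_nonzero by (intro sum.neutral) blast
  ultimately have "(\<Sum>v\<in>UNIV - {0}. R v) = 0"
    by (simp add: sum_diff1)
  moreover have "(\<Sum>v\<in>UNIV - {0}. R v) = (\<Sum>v\<in>UNIV - {0 :: 'm label}. R u)"
    using const by (intro sum.cong) auto
  ultimately have "int (card (UNIV - {0 :: 'm label})) * R u = 0" by simp
  moreover have "card (UNIV - {0 :: 'm label}) \<noteq> 0" 
    using False by (metis Diff_iff UNIV_I card_eq_0_iff empty_iff finite singletonD)
  ultimately show ?thesis by (metis R_def mult_eq_0_iff of_nat_eq_0_iff)
qed

definition orientation_square :: "'m label \<Rightarrow> 'm label \<Rightarrow> int" where
  "orientation_square u v = (\<Sum>w\<in>UNIV. A u w * A w v)"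

lemma orientation_square_commute: "orientation_square v u = orientation_square u v"
  unfolding orientation_square_def
proof (rule sum.cong[OF refl])
  show "A v w * A w u = A u w * A w v" for w
    using orientation_antisym[of v w] orientation_antisym[of w u] by simp
qed

lemma orientation_square_map:
  assumes "\<pi> \<in> H"
  shows "orientation_square (\<pi> u) (\<pi> v) = orientation_square u v"
  unfolding orientation_square_def using bij[OF assms] orientation_map[OF assms]
  by (subst sum.reindex_bij_betw[of \<pi>, symmetric]) auto

lemma orientation_square_const:
  assumes "unordered_transitive D" "(u, v) \<in> D" "(u', v') \<in> D"
  shows "orientation_square u' v' = orientation_square u v"
proof -
  obtain \<pi> where "\<pi> \<in> H" "\<pi> u = u' \<and> \<pi> v = v' \<or> \<pi> u = v' \<and> \<pi> v = u'"
    using assms unfolding unordered_transitive_def by fast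
  then show ?thesis
    using orientation_square_map orientation_square_commute by metis
qed

text \<open>Only common neighbours contribute, each with a sign, so their number controls the size
  and the parity of the entry.\<close>

lemma orientation_square_restrict:
  "orientation_square u v = (\<Sum>w | (u, w) \<in> C \<and> (w, v) \<in> C. A u w * A w v)"
  unfolding orientation_square_def
proof (intro sum.mono_neutral_right ballI)
  fix w assume "w \<in> UNIV - {w. (u, w) \<in> C \<and> (w, v) \<in> C}"
  then have "(u, w) \<notin> C \<or> (w, v) \<notin> C" by blast
  then show "A u w * A w v = 0" using orientation_eq_0 by (metis mult_eq_0_iff)
qed simp_all

lemma orientation_square_signs:
  assumes "w \<in> {w. (u, w) \<in> C \<and> (w, v) \<in> C}"
  shows "A u w * A w v = 1 \<or> A u w * A w v = - 1"
  using assms orientation_sign[of u w] orientation_sign[of w v] by auto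

text \<open>A row of the square sums to 0 because the rows of \<open>A\<close> do. It consists of 0
  at label 0, minus the degree at \<open>u\<close>, and constant entries over the
  \<open>2 * q - 2\<close> commuting and the \<open>2 * q\<close> anticommuting labels.\<close>

lemma orientation_square_sum:
  assumes un: "unordered_transitive commuting_class" "unordered_transitive anticommuting_class"
    and ab: "(u, a) \<in> commuting_class" "(u, b) \<in> anticommuting_class"
    and q: "4 * q = (4 :: int) ^ CARD('m)"
  shows "orientation_square u a * (2 * q - 2) + orientation_square u b * (2 * q) =
    int (card {w. (u, w) \<in> C})"
proof -
  have u: "u \<noteq> 0" using ab by (auto simp: commuting_class_def)
  let ?K = "{v. (u, v) \<in> commuting_class}" and ?L = "{v. (u, v) \<in> anticommuting_class}"
  have "(\<Sum>v\<in>UNIV. orientation_square u v) = (\<Sum>w\<in>UNIV. \<Sum>v\<in>UNIV. A u w * A w v)"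
    unfolding orientation_square_def by (rule sum.swap)
  also have "\<dots> = 0"
    by (simp add: orientation_row_sum flip: sum_distrib_left)
  finally have total: "(\<Sum>v\<in>UNIV. orientation_square u v) = 0" .
  have UNIV: "UNIV = {0} \<union> {u} \<union> ?K \<union> ?L"
    using commutation_sign_cases[of u] u by (auto simp: commuting_class_def anticommuting_class_def)
  have "(\<Sum>v\<in>UNIV. orientation_square u v) =
      orientation_square u 0 + orientation_square u u + sum (orientation_square u) ?K + sum (orientation_square u) ?L"
    unfolding UNIV using u
    by (subst sum.union_disjoint, simp, simp, force simp: commuting_class_def anticommuting_class_def)+ simp
  moreover have "orientation_square u 0 = 0"
    unfolding orientation_square_restrict using C_nonzero by (intro sum.neutral) blast
  moreover have "orientation_square u u = - int (card {w. (u, w) \<in> C})"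
  proof -
    have "orientation_square u u = (\<Sum>w\<in>UNIV. if (u, w) \<in> C then - 1 else 0)"
      unfolding orientation_square_def
    proof (rule sum.cong[OF refl])
      show "A u w * A w u = (if (u, w) \<in> C then - 1 else 0)" for w
        using orientation_antisym[of w u] orientation_sign[of u w] orientation_eq_0[of u w] by auto
    qed
    then show ?thesis by (simp add: sum.If_cases sum_negf)
  qed
  moreover have "sum (orientation_square u) ?K = orientation_square u a * int (card ?K)"
  proof -
    have "sum (orientation_square u) ?K = (\<Sum>v\<in>?K. orientation_square u a)"
      using orientation_square_const[OF un(1) ab(1)] by (intro sum.cong) auto
    then show ?thesis by simp
  qed
  moreover have "sum (orientation_square u) ?L = orientation_square u b * int (card ?L)"
  proof -
    have "sum (orientation_square u) ?L = (\<Sum>v\<in>?L. orientation_square u b)"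
      using orientation_square_const[OF un(2) ab(2)] by (intro sum.cong) auto
    then show ?thesis by simp
  qed
  moreover have "int (card ?L) = 2 * q"
    using card_sign_eq[OF u, of "- 1"] q by (simp add: anticommuting_class_def)
  \<comment> \<open>The labels 0 and \<open>u\<close> commute with \<open>u\<close> but are not its
    neighbours.\<close>
  moreover have "int (card ?K) = 2 * q - 2"
  proof -
    have "{w. commutation_sign u w = 1} = insert 0 (insert u ?K)"
      using u by (auto simp: commuting_class_def)
    then have "card {w. commutation_sign u w = 1} = card ?K + 2"
      using u by (simp add: commuting_class_def)
    then show ?thesis using card_sign_eq[OF u, of 1] q by simp
  qed
  ultimately show ?thesis using total by simp
qed

end

text \<open>With degree \<open>2 * q - 2\<close> the row equation makes \<open>\<gamma>\<close> a
  multiple of \<open>q - 1\<close>, while \<open>q - 1\<close> common neighbours make it odd and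
  bound it by \<open>q - 1\<close>. So \<open>\<gamma>\<close> is \<open>q - 1\<close> up to sign,
  and then \<open>\<beta>\<close> is too large for \<open>q - 3\<close> common neighbours.\<close>

lemma commuting_ordered_transitive:
  assumes m: "CARD('m) \<ge> 2"
    and un: "unordered_transitive commuting_class" "unordered_transitive anticommuting_class"
  shows "ordered_transitive commuting_class"
proof (rule ccontr)
  assume "\<not> ordered_transitive commuting_class"
  then obtain A where A: "orientation commuting_class A"
    using orientation_exists[OF pair_class_commuting un(1)] by blast
  have nz: "\<forall>u v :: 'm label. (u, v) \<in> commuting_class \<longrightarrow> u \<noteq> 0 \<and> v \<noteq> 0"
    unfolding commuting_class_def by blast
  have "(commuting_class :: ('m label \<times> 'm label) set) \<noteq> {}"
  proof
    assume "(commuting_class :: ('m label \<times> 'm label) set) = {}"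
    with \<open>\<not> ordered_transitive commuting_class\<close> show False
      by (simp add: ordered_transitive_def)
  qed
  then obtain u a :: "'m label" where ua: "(u, a) \<in> commuting_class"
    by (metis equals0I surj_pair)
  then have u: "u \<noteq> 0" "a \<noteq> 0" "u \<noteq> a" "commutation_sign u a = 1"
    by (auto simp: commuting_class_def)
  obtain b where "commutation_sign b u = - 1"
    using commutation_sign_nontrivial[OF u(1)] .
  then have ub: "(u, b) \<in> anticommuting_class"
    by (simp add: anticommuting_class_def commutation_sign_commute)
  then have b: "b \<noteq> 0" "u \<noteq> b" "commutation_sign u b = - 1"
    by (auto simp: anticommuting_class_def)
  define q :: int where "q = 4 ^ (CARD('m) - 1)"
  have q: "4 * q = 4 ^ CARD('m)"
    using m by (simp add: q_def flip: power_Suc)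
  have "4 ^ 1 \<le> q" unfolding q_def using m by (intro power_increasing) auto
  have "even q" using m by (simp add: q_def)
  define \<beta> \<gamma> where "\<beta> = orientation_square A u a" and "\<gamma> = orientation_square A u b"
  have card_K: "int (card {w. (u, w) \<in> commuting_class}) = 2 * q - 2"
  proof -
    have "{w. commutation_sign u w = 1} = insert 0 (insert u {w. (u, w) \<in> commuting_class})"
      using u by (auto simp: commuting_class_def)
    then have "card {w. commutation_sign u w = 1} = card {w. (u, w) \<in> commuting_class} + 2"
      using u by (simp add: commuting_class_def)
    then show ?thesis using card_sign_eq[OF u(1), of 1] q by simp
  qed
  have eq: "\<beta> * (2 * q - 2) + \<gamma> * (2 * q) = 2 * q - 2"
    using orientation_square_sum[OF A nz un ua ub q] card_K by (simp add: \<beta>_def \<gamma>_def)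
  let ?S = "\<lambda>v. {w. (u, w) \<in> commuting_class \<and> (w, v) \<in> commuting_class}"
  \<comment> \<open>Of the \<open>q\<close> labels commuting with \<open>u\<close> and
    \<open>a\<close>, the labels 0, \<open>u\<close> and \<open>a\<close> drop out;
    \<open>u + a\<close> stays.\<close>
  have card_a: "int (card (?S a)) = q - 3"
  proof -
    have "?S a = {w. commutation_sign u w = 1 \<and> commutation_sign a w = 1} - {0, u, a}"
      using u by (auto simp: commuting_class_def commutation_sign_commute)
    moreover have "{0, u, a} \<subseteq> {w. commutation_sign u w = 1 \<and> commutation_sign a w = 1}"
      using u by (auto simp: commutation_sign_commute)
    ultimately have "card (?S a) = card {w. commutation_sign u w = 1 \<and> commutation_sign a w = 1} - card {0, u, a}"
      by (simp add: card_Diff_subset)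
    moreover have "card {0, u, a} = 3" using u by auto
    ultimately show ?thesis
      using card_sign_sign_eq[OF u(1-3), of 1 1] q \<open>4 ^ 1 \<le> q\<close> by simp
  qed
  \<comment> \<open>Here only 0 drops out, since \<open>u\<close> and \<open>b\<close> do not
    commute with each other.\<close>
  have card_b: "int (card (?S b)) = q - 1"
  proof -
    have "?S b = {w. commutation_sign u w = 1 \<and> commutation_sign b w = 1} - {0}"
      using u b by (auto simp: commuting_class_def commutation_sign_commute)
    moreover have "{0} \<subseteq> {w. commutation_sign u w = 1 \<and> commutation_sign b w = 1}"
      by auto
    ultimately have "card (?S b) = card {w. commutation_sign u w = 1 \<and> commutation_sign b w = 1} - 1"
      by (simp add: card_Diff_subset)
    then show ?thesis
      using card_sign_sign_eq[OF u(1) b(1,2), of 1 1] q \<open>4 ^ 1 \<le> q\<close> by simp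
  qed
  note signs = orientation_square_signs[OF A nz]
  have "\<bar>\<beta>\<bar> \<le> q - 3"
    unfolding \<beta>_def orientation_square_restrict[OF A nz] card_a[symmetric]
    by (intro sum_signs_bound(1) signs)
  have "\<bar>\<gamma>\<bar> \<le> q - 1"
    unfolding \<gamma>_def orientation_square_restrict[OF A nz] card_b[symmetric]
    by (intro sum_signs_bound(1) signs)
  have "even (\<gamma> - (q - 1))"
    unfolding \<gamma>_def orientation_square_restrict[OF A nz] card_b[symmetric]
    by (intro sum_signs_bound(2) signs)
  then have "odd \<gamma>" using \<open>even q\<close> by simp
  \<comment> \<open>Half the row equation reads
    \<open>(q - 1) * (1 - \<beta>) = q * \<gamma>\<close>; subtracting
    \<open>(q - 1) * \<gamma>\<close> exhibits the factor \<open>t\<close>.\<close>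
  define t where "t = 1 - \<beta> - \<gamma>"
  have \<gamma>: "\<gamma> = (q - 1) * t" using eq by (simp add: t_def algebra_simps)
  with \<open>odd \<gamma>\<close> have "t \<noteq> 0" by auto
  have "(q - 1) * \<bar>t\<bar> \<le> (q - 1) * 1"
    using \<open>\<bar>\<gamma>\<bar> \<le> q - 1\<close> \<open>4 ^ 1 \<le> q\<close> by (simp add: \<gamma> abs_mult)
  then have "\<bar>t\<bar> \<le> 1" by (rule mult_left_le_imp_le) (use \<open>4 ^ 1 \<le> q\<close> in simp)
  then have "t = 1 \<or> t = - 1" using \<open>t \<noteq> 0\<close> by linarith
  moreover have "\<gamma> = q * t - t" using \<gamma> by (simp only: left_diff_distrib mult_1)
  then have "\<beta> = 1 - q * t" using t_def by linarith
  ultimately show False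
    using \<open>\<bar>\<beta>\<bar> \<le> q - 3\<close> by auto
qed

text \<open>The labels \<open>u\<close>, \<open>v\<close>, \<open>u + v\<close> anticommute
  pairwise. An element taking the unordered pair \<open>u\<close>, \<open>v\<close> to
  \<open>v\<close>, \<open>u + v\<close> either rotates this triangle, which is the claim, or swaps
  \<open>u\<close> with \<open>u + v\<close>, which antisymmetry forbids.\<close>

lemma orientation_cyclic:
  assumes A: "orientation anticommuting_class A"
    and un: "unordered_transitive anticommuting_class"
    and uv: "commutation_sign u v = - 1"
  shows "A v (u + v) = A u v"
proof -
  have C: "(u, v) \<in> anticommuting_class" "(v, u + v) \<in> anticommuting_class" "(u + v, u) \<in> anticommuting_class"
    using uv by (auto simp: anticommuting_class_def commutation_sign_add_right
        commutation_sign_add_left commutation_sign_commute[of v u])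
  then obtain \<pi> where \<pi>: "\<pi> \<in> H" "\<pi> u = v \<and> \<pi> v = u + v \<or> \<pi> u = u + v \<and> \<pi> v = v"
    using un unfolding unordered_transitive_def by fast
  have map: "A (\<pi> x) (\<pi> y) = A x y" for x y
    using A \<pi>(1) unfolding orientation_def by blast
  show ?thesis
  proof (cases "\<pi> u = v")
    case True
    then show ?thesis using \<pi>(2) map[of u v] by fastforce
  next
    case False
    then have "\<pi> u = u + v" "\<pi> (u + v) = u"
      using \<pi> additive[OF \<pi>(1), of u v] by (auto simp: add.commute)
    then have "A (u + v) u = A u (u + v)" using map[of u "u + v"] by simp
    moreover have "A (u + v) u = - A u (u + v)" "A (u + v) u = 1 \<or> A (u + v) u = - 1"
      using A C(3) unfolding orientation_def by blast+
    ultimately show ?thesis by simp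
  qed
qed

text \<open>On one qubit at most three Pauli matrices anticommute pairwise, and their labels add up
  to 0. The last three conditions are rearrangements of \<open>p + q + r \<noteq> 0\<close>.\<close>

lemma anticommuting_quadruple:
  assumes "CARD('m) \<ge> 2"
  obtains p q r s :: "'m label" where
    "commutation_sign p q = - 1" "commutation_sign p r = - 1" "commutation_sign p s = - 1"
    "commutation_sign q r = - 1" "commutation_sign q s = - 1" "commutation_sign r s = - 1"
    "r \<noteq> p + q" "p \<noteq> q + r" "q \<noteq> p + r"
proof -
  obtain i j :: 'm where ij: "i \<noteq> j"
    using assms by (metis (full_types) card_2_iff' UNIV_I One_nat_def card_le_Suc0_iff_eq
        finite not_less_eq_eq numeral_2_eq_2)
  let ?e = "\<lambda>i. axis i (1 :: bit)"
  have e: "bit_sign (?e k) (?e l) = (if k = l then - 1 else 1)" for k l :: 'm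
    unfolding bit_sign_axis by (simp add: axis_def)
  \<comment> \<open>Up to phase these are X on qubit \<open>i\<close>, Z on \<open>i\<close>, Y on
    \<open>i\<close> with X on \<open>j\<close>, and Y on \<open>i\<close> with Z on
    \<open>j\<close>.\<close>
  let ?p = "(?e i, 0) :: 'm label" and ?q = "(0, ?e i) :: 'm label"
    and ?r = "(?e i + ?e j, ?e i) :: 'm label" and ?s = "(?e i, ?e i + ?e j) :: 'm label"
  note simps = commutation_sign_def bit_sign_add_left bit_sign_add_right e
  show ?thesis
  proof (rule that[of ?p ?q ?r ?s])
    \<comment> \<open>\<open>?s\<close> anticommutes with each of the other three, hence commutes
      with the sum of any two of them.\<close>
    have "commutation_sign ?s ?r = - 1" "commutation_sign ?s (?p + ?q) = 1"
      "commutation_sign ?s ?p = - 1" "commutation_sign ?s (?q + ?r) = 1"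
      "commutation_sign ?s ?q = - 1" "commutation_sign ?s (?p + ?r) = 1"
      using ij by (simp_all add: simps)
    then show "?r \<noteq> ?p + ?q" "?p \<noteq> ?q + ?r" "?q \<noteq> ?p + ?r"
      by (metis one_neq_neg_one)+
  qed (use ij in \<open>simp_all add: simps\<close>)
qed

text \<open>With degree \<open>2 * q\<close> the row equation makes \<open>\<beta>\<close> a
  multiple of \<open>q\<close>; the bound on \<open>\<beta>\<close> and the parity of
  \<open>\<gamma>\<close> leave \<open>\<gamma> = q\<close> or \<open>\<gamma> = 2 - q\<close>.
  Either value is extreme enough to fix the signs of the summands, and pairwise anticommuting labels
  contradict both patterns.\<close>

lemma anticommuting_ordered_transitive:
  assumes m: "CARD('m) \<ge> 2"
    and un: "unordered_transitive commuting_class" "unordered_transitive anticommuting_class"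
  shows "ordered_transitive anticommuting_class"
proof (rule ccontr)
  assume "\<not> ordered_transitive anticommuting_class"
  then obtain A where A: "orientation anticommuting_class A"
    using orientation_exists[OF pair_class_anticommuting un(2)] by blast
  have nz: "\<forall>u v :: 'm label. (u, v) \<in> anticommuting_class \<longrightarrow> u \<noteq> 0 \<and> v \<noteq> 0"
    by (intro allI impI) (auto simp: anticommuting_class_def)
  have antisym: "A y x = - A x y" for x y
    using orientation_antisym[OF A nz] .
  have sign: "A x y = 1 \<or> A x y = - 1" if "commutation_sign x y = - 1" for x y
    using orientation_sign[OF A nz] that by (simp add: anticommuting_class_def)
  obtain u b r s :: "'m label" where quad:
    "commutation_sign u b = - 1" "commutation_sign u r = - 1" "commutation_sign u s = - 1"
    "commutation_sign b r = - 1" "commutation_sign b s = - 1" "commutation_sign r s = - 1"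
    and indep: "r \<noteq> u + b" "u \<noteq> b + r" "b \<noteq> u + r"
    using anticommuting_quadruple[OF m] .
  have ub: "(u, b) \<in> anticommuting_class"
    using quad by (simp add: anticommuting_class_def)
  have u: "u \<noteq> 0" using quad by auto
  define q :: int where "q = 4 ^ (CARD('m) - 1)"
  have q: "4 * q = 4 ^ CARD('m)"
    using m by (simp add: q_def flip: power_Suc)
  have "4 ^ 1 \<le> q" unfolding q_def using m by (intro power_increasing) auto
  have "even q" using m by (simp add: q_def)
  \<comment> \<open>\<open>u\<close> has a neighbour in the graph because \<open>2 * q\<close>
    labels commute with it and \<open>q\<close> is at least 4.\<close>
  have "\<not> {w. commutation_sign u w = 1} \<subseteq> {0, u}"
  proof
    assume "{w. commutation_sign u w = 1} \<subseteq> {0, u}"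
    then have "card {w. commutation_sign u w = 1} \<le> card {0, u}"
      by (intro card_mono) auto
    then have "card {w. commutation_sign u w = 1} \<le> 2"
      by (simp add: card_insert_if split: if_splits)
    then show False
      using card_sign_eq[OF u, of 1] q \<open>4 ^ 1 \<le> q\<close> by simp
  qed
  then obtain a where ua: "(u, a) \<in> commuting_class"
    using u by (auto simp: commuting_class_def)
  have a: "a \<noteq> 0" "u \<noteq> a" using ua by (auto simp: commuting_class_def)
  define \<beta> \<gamma> where "\<beta> = orientation_square A u a" and "\<gamma> = orientation_square A u b"
  have "int (card {w. (u, w) \<in> anticommuting_class}) = 2 * q"
    using card_sign_eq[OF u, of "- 1"] q by (simp add: anticommuting_class_def)
  then have eq: "\<beta> * (2 * q - 2) + \<gamma> * (2 * q) = 2 * q"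
    using orientation_square_sum[OF A nz un ua ub q] by (simp add: \<beta>_def \<gamma>_def)
  let ?S = "\<lambda>u v. {w. (u, w) \<in> anticommuting_class \<and> (w, v) \<in> anticommuting_class}"
  have card_S: "int (card (?S x y)) = q" if "x \<noteq> 0" "y \<noteq> 0" "x \<noteq> y" for x y :: "'m label"
    using card_sign_sign_eq[OF that, of "- 1" "- 1"] q
    by (simp add: anticommuting_class_def commutation_sign_commute)
  have mem_S: "w \<in> ?S x y \<longleftrightarrow> commutation_sign x w = - 1 \<and> commutation_sign y w = - 1" for w x y :: "'m label"
    using commutation_sign_commute[of w y] by (simp add: anticommuting_class_def)
  note restrict = orientation_square_restrict[OF A nz]
  note signs = orientation_square_signs[OF A nz]
  have b: "b \<noteq> 0" "u \<noteq> b" using quad by auto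
  have "\<bar>\<beta>\<bar> \<le> q"
    unfolding \<beta>_def restrict card_S[OF u a, symmetric] by (intro sum_signs_bound(1) signs)
  have "even (\<gamma> - q)"
    unfolding \<gamma>_def restrict card_S[OF u b, symmetric] by (intro sum_signs_bound(2) signs)
  then have "even \<gamma>" using \<open>even q\<close> by simp
  define t where "t = \<beta> - 1 + \<gamma>"
  have \<beta>: "\<beta> = q * t" using eq by (simp add: t_def algebra_simps)
  have \<gamma>: "\<gamma> = t + 1 - q * t" using \<beta> t_def by linarith
  \<comment> \<open>For \<open>t = 0\<close> one would have \<open>\<beta> = 0\<close> and
    \<open>\<gamma> = 1\<close>, which is odd.\<close>
  have "t \<noteq> 0" using \<beta> \<open>even \<gamma>\<close> by (auto simp: t_def)
  have "q * \<bar>t\<bar> \<le> q * 1"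
    using \<open>\<bar>\<beta>\<bar> \<le> q\<close> \<open>4 ^ 1 \<le> q\<close> by (simp add: \<beta> abs_mult)
  then have "\<bar>t\<bar> \<le> 1" by (rule mult_left_le_imp_le) (use \<open>4 ^ 1 \<le> q\<close> in simp)
  then have "t = 1 \<or> t = - 1" using \<open>t \<noteq> 0\<close> by linarith
  have square: "(\<Sum>w\<in>?S x y. A x w * A w y) = \<gamma>" if "commutation_sign x y = - 1" for x y
  proof -
    have "(x, y) \<in> anticommuting_class"
      using that by (simp add: anticommuting_class_def)
    then have "orientation_square A x y = \<gamma>"
      unfolding \<gamma>_def by (rule orientation_square_const[OF A nz un(2) ub])
    then show ?thesis
      by (simp only: restrict)
  qed
  from \<open>t = 1 \<or> t = - 1\<close> show False
  proof
    assume "t = - 1"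
    then have "\<gamma> = q" using \<gamma> by simp
    \<comment> \<open>The \<open>q\<close> summands are signs with sum \<open>q\<close>, so each is
      1: every common neighbour lies on a directed path of length two between \<open>x\<close> and
      \<open>y\<close>.\<close>
    have pos: "A x w * A w y = 1"
      if "commutation_sign x y = - 1" "commutation_sign x w = - 1" "commutation_sign y w = - 1" for x y w
    proof -
      have xy: "x \<noteq> 0" "y \<noteq> 0" "x \<noteq> y" using that by auto
      have "(\<Sum>w\<in>?S x y. 1 - A x w * A w y) = 0"
        using square[OF that(1)] card_S[OF xy] \<open>\<gamma> = q\<close> by (simp add: sum_subtractf)
      moreover have "0 \<le> 1 - A x w * A w y" if "w \<in> ?S x y" for w
        using signs[OF that] by linarith
      ultimately have all: "\<forall>w\<in>?S x y. 1 - A x w * A w y = 0"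
        by (subst (asm) sum_nonneg_eq_0_iff) auto
      have "w \<in> ?S x y" unfolding mem_S using that by blast
      then have "1 - A x w * A w y = 0" by (rule bspec[OF all])
      then show ?thesis by simp
    qed
    \<comment> \<open>Of any two among the three arcs joining \<open>s\<close> to \<open>u\<close>,
      \<open>b\<close>, \<open>r\<close>, one would have to enter \<open>s\<close> and the other to
      leave it, which is impossible for three arcs.\<close>
    have "A u s * A s b = 1" "A b s * A s r = 1" "A u s * A s r = 1"
      by (rule pos[OF quad(1,3,5)] pos[OF quad(4,5,6)] pos[OF quad(2,3,6)])+
    then show False
      using antisym[of s b] sign[OF quad(3)] sign[OF quad(5)] by auto
  next
    assume "t = 1"
    then have "\<gamma> = 2 - q" using \<gamma> by simp
    \<comment> \<open>Rotating the triangle gives the summand at \<open>x + y\<close> the value 1,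
      so the other \<open>q - 1\<close> summands add up to \<open>1 - q\<close> and each is
      -1.\<close>
    have neg: "A x w * A w y = - 1"
      if "commutation_sign x y = - 1" "commutation_sign x w = - 1" "commutation_sign y w = - 1" "w \<noteq> x + y"
      for x y w
    proof -
      have xy: "x \<noteq> 0" "y \<noteq> 0" "x \<noteq> y" using that by auto
      have xy_S: "x + y \<in> ?S x y"
        unfolding mem_S using that(1) commutation_sign_commute[of y x]
        by (simp add: commutation_sign_add_right)
      have c1: "A y (x + y) = A x y"
        by (rule orientation_cyclic[OF A un(2) that(1)])
      have "commutation_sign y (x + y) = - 1"
        using that(1) commutation_sign_commute[of y x] by (simp add: commutation_sign_add_right)
      then have "A (x + y) (y + (x + y)) = A y (x + y)"
        by (rule orientation_cyclic[OF A un(2)])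
      moreover have "y + (x + y) = x"
        by (subst add.commute[of x y]) simp
      ultimately have "A x (x + y) = - A x y" "A (x + y) y = - A x y"
        using c1 antisym[of "x + y" x] antisym[of y "x + y"] by simp_all
      then have "A x (x + y) * A (x + y) y = 1"
        using sign[OF that(1)] by auto
      moreover have "(\<Sum>w\<in>?S x y. 1 + A x w * A w y) = 2"
        using square[OF that(1)] card_S[OF xy] \<open>\<gamma> = 2 - q\<close> by (simp add: sum.distrib)
      ultimately have sum0: "(\<Sum>w\<in>?S x y - {x + y}. 1 + A x w * A w y) = 0"
        unfolding sum_diff1[OF finite] using xy_S by simp
      have nonneg: "0 \<le> 1 + A x w * A w y" if "w \<in> ?S x y - {x + y}" for w
      proof -
        have "w \<in> ?S x y" using that by (rule DiffD1)
        from signs[OF this] show ?thesis by linarith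
      qed
      have all: "\<forall>w\<in>?S x y - {x + y}. 1 + A x w * A w y = 0"
        by (rule sum_nonneg_eq_0_iff[THEN iffD1, OF _ nonneg sum0]) simp
      have "w \<in> ?S x y - {x + y}"
        using that mem_S[of w x y] by blast
      then have "1 + A x w * A w y = 0" by (rule bspec[OF all])
      then show ?thesis by simp
    qed
    have flip: "commutation_sign b u = - 1" "commutation_sign r u = - 1" "commutation_sign r b = - 1"
      by (subst commutation_sign_commute, rule quad(1),
        subst commutation_sign_commute, rule quad(2), subst commutation_sign_commute, rule quad(4))
    have indep': "r \<noteq> b + u" "u \<noteq> r + b"
      using indep(1,2) unfolding add.commute[of u b] add.commute[of b r] .
    \<comment> \<open>Multiplying the three equations gives a square on the left and -1 on the
      right.\<close>
    have "A u b * A b r = - 1" "A b r * A r u = - 1" "A r u * A u b = - 1"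
      by (rule neg[OF quad(2,1) flip(3) indep(3)] neg[OF flip(1) quad(4) quad(2) indep'(1)]
          neg[OF flip(3,2,1) indep'(2)])+
    then show False
      using sign[OF quad(1)] sign[OF quad(4)] by auto
  qed
qed

end

section \<open>The action of a Clifford subgroup on labels\<close>

lemma cscale_inject: "c \<noteq> 0 \<Longrightarrow> cscale c A = cscale c B \<longleftrightarrow> A = B"
  by (simp add: vec_eq_iff)

text \<open>For Clifford elements the choice is unique, since Pauli matrices with different labels
  are not proportional. The modulus 1 of the phase is recorded because it must cancel against its
  conjugate in the twirls.\<close>

definition label_action :: "(bit^'m::finite) cmat \<Rightarrow> 'm label \<Rightarrow> 'm label" where
  "label_action g u = (SOME v. \<exists>c. cmod c = 1 \<and> conjugate_by g (pauli u) = cscale c (pauli v))"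

definition vertex :: "'m::finite label \<Rightarrow> (bit^'m) cmat set" where
  "vertex u = {pauli_E (fst u) (snd u), - pauli_E (fst u) (snd u)}"

lemma pauli_E_phase:
  obtains c where "c \<noteq> 0" "pauli_E (fst u) (snd u) = cscale c (pauli u)"
  by (rule that[of "\<i> ^ (\<Sum>i\<in>UNIV. of_bool (fst u $ i = 1) * of_bool (snd u $ i = 1))"])
    (simp_all add: pauli_E_def pauli_def)

lemma vertex_phase:
  assumes "A \<in> vertex u"
  obtains c where "c \<noteq> 0" "A = cscale c (pauli u)"
proof -
  obtain c where c: "c \<noteq> 0" "pauli_E (fst u) (snd u) = cscale c (pauli u)"
    using pauli_E_phase .
  then have "A = cscale c (pauli u) \<or> A = cscale (- c) (pauli u)"
    using assms by (auto simp: vertex_def minus_eq_cscale)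
  then show ?thesis using that[of c] that[of "- c"] c(1) by auto
qed

lemma vertex_nonempty: "pauli_E (fst u) (snd u) \<in> vertex u"
  by (simp add: vertex_def)

lemma vertex_inject: "vertex u = vertex v \<longleftrightarrow> u = v"
proof
  assume eq: "vertex u = vertex v"
  obtain c where c: "c \<noteq> 0" "pauli_E (fst u) (snd u) = cscale c (pauli u)"
    using pauli_E_phase .
  have "pauli_E (fst u) (snd u) \<in> vertex v"
    using eq vertex_nonempty by metis
  then obtain d where "pauli_E (fst u) (snd u) = cscale d (pauli v)"
    using vertex_phase by metis
  then have "cscale c (pauli u) = cscale d (pauli v)" using c(2) by simp
  then show "u = v" using c(1) by (rule cscale_pauli_eqD(1))
qed simp

lemma hw_vertices_eq: "hw_vertices = vertex ` (- {0})"
proof (intro equalityI subsetI)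
  fix x :: "(bit^'a) cmat set"
  assume "x \<in> hw_vertices"
  then obtain a b where ab: "x = {pauli_E a b, - pauli_E a b}" "(a, b) \<noteq> (0, 0)"
    unfolding hw_vertices_def by blast
  then have "x = vertex (a, b)" "(a, b) \<in> - {0}"
    by (simp_all add: vertex_def zero_prod_def)
  then show "x \<in> vertex ` (- {0})" by (rule image_eqI)
next
  fix x :: "(bit^'a) cmat set"
  assume "x \<in> vertex ` (- {0})"
  then obtain u where u: "x = vertex u" "u \<noteq> 0" by blast
  then have "(fst u, snd u) \<noteq> (0, 0)" by (simp add: zero_prod_def)
  then show "x \<in> hw_vertices" unfolding hw_vertices_def u(1) vertex_def by blast
qed

lemma vertex_commute_iff:
  "(\<forall>A\<in>vertex u. \<forall>B\<in>vertex v. A ** B = B ** A) \<longleftrightarrow> commutation_sign u v = 1"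
proof -
  have "A ** B = B ** A \<longleftrightarrow> commutation_sign u v = 1" if AB: "A \<in> vertex u" "B \<in> vertex v" for A B
  proof -
    obtain a b where ab: "a \<noteq> 0" "b \<noteq> 0" "A = cscale a (pauli u)" "B = cscale b (pauli v)"
      using AB vertex_phase by metis
    have "A ** B = B ** A \<longleftrightarrow> pauli u ** pauli v = pauli v ** pauli u"
      unfolding ab(3,4) cscale_mult_left cscale_mult_right cscale_cscale mult.commute[of b a]
      using ab(1,2) by (simp only: cscale_inject mult_eq_0_iff simp_thms)
    then show ?thesis by (simp only: pauli_commute_iff)
  qed
  then show ?thesis using vertex_nonempty by metis
qed

lemma hw_adjacent_iff:
  assumes "u \<noteq> 0" "v \<noteq> 0"
  shows "hw_adjacent (vertex u) (vertex v) \<longleftrightarrow> (u, v) \<in> commuting_class"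
  using assms by (simp add: hw_adjacent_def hw_vertices_eq vertex_commute_iff vertex_inject commuting_class_def)

lemma hw_nonadjacent_iff:
  assumes "u \<noteq> 0" "v \<noteq> 0"
  shows "hw_nonadjacent (vertex u) (vertex v) \<longleftrightarrow> (u, v) \<in> anticommuting_class"
proof -
  have "vertex u \<in> hw_vertices" "vertex v \<in> hw_vertices"
    using assms by (simp_all add: hw_vertices_eq)
  then show ?thesis
    using assms commutation_sign_cases[of u v] commutation_sign_self[of v]
    by (auto simp: hw_nonadjacent_def hw_adjacent_iff vertex_inject commuting_class_def anticommuting_class_def)
qed

lemma adjacent_if_commuting: "(u, v) \<in> commuting_class \<Longrightarrow> hw_adjacent (vertex u) (vertex v)"
  using hw_adjacent_iff[of u v] by (simp add: commuting_class_def)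

lemma nonadjacent_if_anticommuting:
  assumes "(u, v) \<in> anticommuting_class"
  shows "hw_nonadjacent (vertex u) (vertex v)"
proof -
  have "commutation_sign u v = - 1" using assms by (simp add: anticommuting_class_def)
  then have "u \<noteq> 0" "v \<noteq> 0" by auto
  then show ?thesis using hw_nonadjacent_iff assms by blast
qed

section \<open>A finite Clifford subgroup and its action on labels\<close>

context
  fixes G :: "(bit^'m::finite) cmat set"
  assumes subgroup: "subgroup G clifford_group"
    and finite: "finite G"
    and paulis: "\<And>a b. pauli_D a b \<in> G"
begin

lemma G_unitary: "G \<subseteq> unitary_matrices"
  using subgroup.subset[OF subgroup] by (auto simp: clifford_group_def)

lemma G_mult: "g \<in> G \<Longrightarrow> h \<in> G \<Longrightarrow> g ** h \<in> G"
  using subgroup.m_closed[OF subgroup] by (simp add: clifford_group_def)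

lemma G_one: "mat 1 \<in> G"
  using subgroup.one_closed[OF subgroup] by (simp add: clifford_group_def)

lemma G_nonempty: "G \<noteq> {}"
  using G_one by blast

text \<open>Right multiplication by \<open>g\<close> is injective on the finite set
  \<open>G\<close>, hence onto, and so reaches \<open>mat 1\<close>.\<close>

lemma G_left_inverse:
  assumes "g \<in> G"
  obtains h where "h \<in> G" "h ** g = mat 1"
proof -
  have "inj_on (\<lambda>h. h ** g) G"
    using assms G_unitary unitary_mult_right_cancel by (intro inj_onI) blast
  then have "(\<lambda>h. h ** g) ` G = G"
    using finite assms G_mult by (intro endo_inj_surj) auto
  then show ?thesis using G_one that by (metis (no_types, lifting) imageE)
qed

lemma label_action_phase:
  assumes "g \<in> G"
  obtains c where "cmod c = 1" "conjugate_by g (pauli u) = cscale c (pauli (label_action g u))"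
proof -
  have "conjugate_by g (pauli u) \<in> heisenberg_weyl"
    using assms subgroup.subset[OF subgroup] by (auto simp: clifford_group_def pauli_def)
  then obtain k a b where "conjugate_by g (pauli u) = cscale (\<i> ^ k) (pauli_D a b)"
    by (auto simp: heisenberg_weyl_def)
  then have "\<exists>c. cmod c = 1 \<and> conjugate_by g (pauli u) = cscale c (pauli (a, b))"
    by (intro exI[of _ "\<i> ^ k"]) (simp add: pauli_def norm_power)
  then have "\<exists>c. cmod c = 1 \<and> conjugate_by g (pauli u) = cscale c (pauli (label_action g u))"
    unfolding label_action_def by (rule someI)
  then show ?thesis using that by blast
qed

lemma label_action_eqI:
  assumes "g \<in> G" "conjugate_by g (pauli u) = cscale c (pauli v)" "c \<noteq> 0"
  shows "label_action g u = v"
proof -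
  obtain d where "conjugate_by g (pauli u) = cscale d (pauli (label_action g u))"
    using label_action_phase[OF assms(1)] by metis
  then have "cscale c (pauli v) = cscale d (pauli (label_action g u))"
    using assms(2) by simp
  then show ?thesis using cscale_pauli_eqD(1)[OF _ assms(3)] by metis
qed

text \<open>A vertex determines its Pauli matrix up to a nonzero factor, and a label is insensitive
  to that factor.\<close>

lemma label_action_eqI_vertex:
  assumes g: "g \<in> G" and "act_vertex g (vertex u) = vertex v"
  shows "label_action g u = v"
proof -
  obtain c where c: "c \<noteq> 0" "pauli_E (fst u) (snd u) = cscale c (pauli u)"
    using pauli_E_phase .
  have "conjugate_by g (pauli_E (fst u) (snd u)) \<in> vertex v"
    using assms(2) vertex_nonempty unfolding act_vertex_def by blast
  then obtain d where d: "d \<noteq> 0" "conjugate_by g (pauli_E (fst u) (snd u)) = cscale d (pauli v)"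
    using vertex_phase by metis
  then have "cscale (1 / c) (cscale c (conjugate_by g (pauli u))) = cscale (1 / c) (cscale d (pauli v))"
    by (simp add: c(2))
  then have "conjugate_by g (pauli u) = cscale (d / c) (pauli v)"
    using c(1) by simp
  then show ?thesis using label_action_eqI[OF g] c(1) d(1) by simp
qed

lemma label_action_mult:
  assumes "g \<in> G" "h \<in> G"
  shows "label_action (g ** h) u = label_action g (label_action h u)"
proof -
  obtain c where c: "cmod c = 1" "conjugate_by h (pauli u) = cscale c (pauli (label_action h u))"
    using label_action_phase[OF assms(2)] .
  obtain d where d: "cmod d = 1" "conjugate_by g (pauli (label_action h u)) =
      cscale d (pauli (label_action g (label_action h u)))"
    using label_action_phase[OF assms(1)] .
  have "conjugate_by (g ** h) (pauli u) = cscale (c * d) (pauli (label_action g (label_action h u)))"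
    by (simp add: conjugate_by_mult c(2) d(2))
  moreover have "c * d \<noteq> 0" using c(1) d(1) by auto
  ultimately show ?thesis using label_action_eqI G_mult assms by blast
qed

lemma label_action_one: "label_action (mat 1) (u :: 'm label) = u"
  by (rule label_action_eqI[OF G_one, of _ 1]) (simp_all add: conjugate_by_def)

text \<open>Conjugation is multiplicative, and a product of Pauli matrices carries the sum of the
  labels up to a sign, which the label forgets.\<close>

lemma label_action_add:
  assumes g: "g \<in> G"
  shows "label_action g (u + v) = label_action g u + label_action g v"
proof -
  obtain c where c: "cmod c = 1" "conjugate_by g (pauli u) = cscale c (pauli (label_action g u))"
    using label_action_phase[OF g] .
  obtain d where d: "cmod d = 1" "conjugate_by g (pauli v) = cscale d (pauli (label_action g v))"
    using label_action_phase[OF g] .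
  define s :: complex where "s = of_int (bit_sign (snd u) (fst v))"
  define t :: complex where "t = of_int (bit_sign (snd (label_action g u)) (fst (label_action g v)))"
  have st: "s * s = 1" "t \<noteq> 0"
    using bit_sign_cases[of "snd (label_action g u)" "fst (label_action g v)"]
    by (auto simp: s_def t_def simp flip: of_int_mult)
  have "cscale s (pauli u ** pauli v) = pauli (u + v)"
    by (simp add: pauli_mult st(1) flip: s_def)
  then have "conjugate_by g (pauli (u + v)) = cscale s (conjugate_by g (pauli u ** pauli v))"
    by (metis conjugate_by_cscale)
  also have "conjugate_by g (pauli u ** pauli v) = conjugate_by g (pauli u) ** conjugate_by g (pauli v)"
    using g G_unitary by (intro conjugate_by_prod) auto
  also have "\<dots> = cscale (d * c * t) (pauli (label_action g u + label_action g v))"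
    by (simp add: c(2) d(2) pauli_mult t_def mult.assoc)
  finally have "conjugate_by g (pauli (u + v)) =
      cscale (s * (d * c * t)) (pauli (label_action g u + label_action g v))" by simp
  moreover have "s * (d * c * t) \<noteq> 0" using st c(1) d(1) by auto
  ultimately show ?thesis using label_action_eqI[OF g] by blast
qed

text \<open>Conjugation by a unitary preserves and reflects commuting, and this decides a sign that
  has only two possible values.\<close>

lemma label_action_sign:
  assumes g: "g \<in> G"
  shows "commutation_sign (label_action g u) (label_action g v) = commutation_sign u v"
proof -
  have unitary: "g \<in> unitary_matrices" using g G_unitary by blast
  obtain c where c: "cmod c = 1" "conjugate_by g (pauli u) = cscale c (pauli (label_action g u))"
    using label_action_phase[OF g] .
  obtain d where d: "cmod d = 1" "conjugate_by g (pauli v) = cscale d (pauli (label_action g v))"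
    using label_action_phase[OF g] .
  have nz: "c \<noteq> 0" "d \<noteq> 0" using c(1) d(1) by auto
  have "commutation_sign u v = 1 \<longleftrightarrow> conjugate_by g (pauli u ** pauli v) = conjugate_by g (pauli v ** pauli u)"
    unfolding pauli_commute_iff[symmetric]
    using conjugate_by_inject[OF unitary, of "pauli u ** pauli v" "pauli v ** pauli u"] by auto
  also have "\<dots> \<longleftrightarrow> cscale (c * d) (pauli (label_action g u) ** pauli (label_action g v)) =
      cscale (c * d) (pauli (label_action g v) ** pauli (label_action g u))"
    by (simp add: conjugate_by_prod[OF unitary] c(2) d(2) mult.commute)
  also have "\<dots> \<longleftrightarrow> commutation_sign (label_action g u) (label_action g v) = 1"
    unfolding pauli_commute_iff[symmetric] using nz by (simp only: cscale_inject mult_eq_0_iff simp_thms)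
  finally show ?thesis
    using commutation_sign_cases[of u v] commutation_sign_cases[of "label_action g u" "label_action g v"] by auto
qed

lemma symplectic_maps_label_action:
  assumes "transitive_on G act_vertex hw_vertices"
  shows "symplectic_maps (label_action ` G)"
proof
  show "\<pi> \<circ> \<rho> \<in> label_action ` G" if H: "\<pi> \<in> label_action ` G" "\<rho> \<in> label_action ` G" for \<pi> \<rho>
  proof -
    obtain g h where gh: "g \<in> G" "\<pi> = label_action g" "h \<in> G" "\<rho> = label_action h"
      using H by blast
    then have "\<pi> \<circ> \<rho> = label_action (g ** h)"
      by (intro ext) (simp add: label_action_mult)
    then show ?thesis using gh G_mult by blast
  qed
  show "\<exists>\<rho>\<in>label_action ` G. \<rho> \<circ> \<pi> = id" if H: "\<pi> \<in> label_action ` G" for \<pi>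
  proof -
    obtain g where g: "g \<in> G" "\<pi> = label_action g" using H by blast
    obtain h where h: "h \<in> G" "h ** g = mat 1" using G_left_inverse[OF g(1)] .
    have "label_action h \<circ> \<pi> = id"
      by (intro ext) (simp add: g(2) h(2) label_action_one flip: label_action_mult[OF h(1) g(1)])
    then show ?thesis using h(1) by blast
  qed
  show "\<pi> (u + v) = \<pi> u + \<pi> v" if "\<pi> \<in> label_action ` G" for \<pi> u v
    using that label_action_add by blast
  show "commutation_sign (\<pi> u) (\<pi> v) = commutation_sign u v" if "\<pi> \<in> label_action ` G" for \<pi> u v
    using that label_action_sign by blast
  show "\<exists>\<pi>\<in>label_action ` G. \<pi> u = v" if "u \<noteq> 0" "v \<noteq> 0" for u v
  proof -
    have "vertex u \<in> hw_vertices" "vertex v \<in> hw_vertices"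
      using that by (simp_all add: hw_vertices_eq)
    then obtain g where "g \<in> G" "act_vertex g (vertex u) = vertex v"
      using assms unfolding transitive_on_def by blast
    then show ?thesis using label_action_eqI_vertex by blast
  qed
qed

lemma unordered_transitive_label_action:
  assumes S: "symplectic_maps (label_action ` G)"
    and tr: "transitive_on G (\<lambda>g e. act_vertex g ` e) (unordered_pairs R)"
    and R: "\<And>u v. (u, v) \<in> C \<Longrightarrow> R (vertex u) (vertex v)"
  shows "symplectic_maps.unordered_transitive (label_action ` G) C"
proof -
  have "\<exists>\<pi>\<in>label_action ` G. \<pi> u = u' \<and> \<pi> v = v' \<or> \<pi> u = v' \<and> \<pi> v = u'"
    if C: "(u, v) \<in> C" "(u', v') \<in> C" for u v u' v'
  proof -
    have "{vertex u, vertex v} \<in> unordered_pairs R" "{vertex u', vertex v'} \<in> unordered_pairs R"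
      using R C unfolding unordered_pairs_def by blast+
    then obtain g where g: "g \<in> G" "act_vertex g ` {vertex u, vertex v} = {vertex u', vertex v'}"
      using tr unfolding transitive_on_def by meson
    then have "act_vertex g (vertex u) = vertex u' \<and> act_vertex g (vertex v) = vertex v' \<or>
        act_vertex g (vertex u) = vertex v' \<and> act_vertex g (vertex v) = vertex u'"
      by (simp add: doubleton_eq_iff)
    then show ?thesis using g(1) label_action_eqI_vertex by blast
  qed
  then show ?thesis
    unfolding symplectic_maps.unordered_transitive_def[OF S] by blast
qed

lemma ordered_transitive_label_action:
  assumes S: "symplectic_maps (label_action ` G)"
    and tr: "transitive_on G (\<lambda>g (u, v). (act_vertex g u, act_vertex g v)) (ordered_pairs R)"
    and R: "\<And>u v. (u, v) \<in> C \<Longrightarrow> R (vertex u) (vertex v)"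
  shows "symplectic_maps.ordered_transitive (label_action ` G) C"
proof -
  have "\<exists>\<pi>\<in>label_action ` G. \<pi> u = u' \<and> \<pi> v = v'"
    if C: "(u, v) \<in> C" "(u', v') \<in> C" for u v u' v'
  proof -
    have "(vertex u, vertex v) \<in> ordered_pairs R" "(vertex u', vertex v') \<in> ordered_pairs R"
      using R C unfolding ordered_pairs_def by blast+
    then obtain g where g: "g \<in> G"
        "(case (vertex u, vertex v) of (x, y) \<Rightarrow> (act_vertex g x, act_vertex g y)) = (vertex u', vertex v')"
      using tr unfolding transitive_on_def by meson
    then have "act_vertex g (vertex u) = vertex u'" "act_vertex g (vertex v) = vertex v'"
      by simp_all
    then show ?thesis using label_action_eqI_vertex[OF g(1)] g(1) by blast
  qed
  then show ?thesis
    unfolding symplectic_maps.ordered_transitive_def[OF S] by blast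
qed

section \<open>Twirls of Pauli products\<close>

lemma G_mult_pauli: "g \<in> G \<Longrightarrow> g ** pauli u \<in> G"
  using G_mult paulis by (simp add: pauli_def)

lemma twirl_conjugate_G:
  "g \<in> G \<Longrightarrow> twirl G (conjugate_by (tensor_power g) X) = twirl G X"
  using finite G_mult G_unitary by (intro twirl_conjugate) auto

text \<open>The phase \<open>c\<close> of the first factor meets its conjugate in the
  second.\<close>

lemma twirl_pauli2_label_action:
  assumes g: "g \<in> G"
  shows "twirl G (pauli2 (label_action g u)) = twirl G (pauli2 u)"
proof -
  obtain c where c: "cmod c = 1" "conjugate_by g (pauli u) = cscale c (pauli (label_action g u))"
    using label_action_phase[OF g] .
  have "c * cnj c = 1" using c(1) by (simp add: complex_norm_square[symmetric])
  then have "conjugate_by (tensor_power g) (pauli2 u) = pauli2 (label_action g u)"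
    by (simp add: pauli2_def conjugate_by_tensor2 conjugate_by_adjoint c(2) vec_eq_iff tensor2_nth)
  then show ?thesis using twirl_conjugate_G[OF g, of "pauli2 u"] by simp
qed

text \<open>The adjoint in the third factor makes the phases picked up by conjugation cancel.\<close>

lemma twirl_pauli3_label_action:
  assumes g: "g \<in> G"
  shows "twirl G (pauli3 (label_action g u, label_action g v)) = twirl G (pauli3 (u, v))"
proof -
  have unitary: "g \<in> unitary_matrices" using g G_unitary by blast
  obtain c where c: "cmod c = 1" "conjugate_by g (pauli u) = cscale c (pauli (label_action g u))"
    using label_action_phase[OF g] .
  obtain d where d: "cmod d = 1" "conjugate_by g (pauli v) = cscale d (pauli (label_action g v))"
    using label_action_phase[OF g] .
  have "c * cnj c = 1" "d * cnj d = 1"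
    using c(1) d(1) by (simp_all add: complex_norm_square[symmetric])
  moreover have "conjugate_by (tensor_power g) (pauli3 (u, v)) =
      tensor3 (cscale c (pauli (label_action g u))) (cscale d (pauli (label_action g v)))
        (adjoint_mat (cscale c (pauli (label_action g u)) ** cscale d (pauli (label_action g v))))"
    by (simp only: pauli3_def conjugate_by_tensor3 conjugate_by_adjoint conjugate_by_prod[OF unitary]
        c(2) d(2) fst_conv snd_conv)
  moreover have "\<dots> = cscale ((c * cnj c) * (d * cnj d)) (pauli3 (label_action g u, label_action g v))"
    by (simp add: pauli3_def tensor3_cscale mult_ac)
  ultimately have "conjugate_by (tensor_power g) (pauli3 (u, v)) = pauli3 (label_action g u, label_action g v)"
    by simp
  then show ?thesis using twirl_conjugate_G[OF g, of "pauli3 (u, v)"] by simp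
qed

lemma twirl_tensor2_commutant:
  assumes S: "symplectic_maps (label_action ` G)"
  shows "twirl G (X :: ((bit^'m)^2) cmat) \<in> tensor_commutant"
proof (rule twirl_commutant_if_paulis)
  interpret symplectic_maps "label_action ` G" by (rule S)
  have pauli2: "twirl G (pauli2 u) \<in> tensor_commutant" for u
  proof (cases "u = 0")
    case True
    then show ?thesis
      using finite G_nonempty G_unitary by (simp add: pauli2_0 twirl_commutant tensor_commutant_one)
  next
    case False
    \<comment> \<open>The nonzero labels form one orbit, and their sum is a multiple of the swap
      minus the identity.\<close>
    have "(\<Sum>u\<in>UNIV - {0 :: 'm label}. pauli2 u) = (\<Sum>u\<in>UNIV. pauli2 u) - mat 1"
      by (simp add: sum_diff1 pauli2_0)
    also have "\<dots> \<in> tensor_commutant"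
      by (intro tensor_commutant_diff sum_pauli2_commutant tensor_commutant_one)
    finally have sum: "(\<Sum>u\<in>UNIV - {0 :: 'm label}. pauli2 u) \<in> tensor_commutant" .
    show ?thesis
    proof (rule twirl_orbit_commutant[OF finite G_nonempty G_unitary _ _ sum])
      show "twirl G (pauli2 p) = twirl G (pauli2 q)" if "p \<in> UNIV - {0}" "q \<in> UNIV - {0}" for p q :: "'m label"
      proof -
        have "q \<noteq> 0" "p \<noteq> 0" using that by auto
        then obtain g where "g \<in> G" "label_action g q = p"
          using transitive[of q p] by blast
        then show ?thesis using twirl_pauli2_label_action by blast
      qed
    qed (use False in auto)
  qed
  fix P :: "('m label)^2"
  show "twirl G (tensor_family (\<lambda>i. pauli (P $ i))) \<in> tensor_commutant"
  proof (cases "(\<Sum>i\<in>UNIV. P $ i) = 0")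
    case True
    \<comment> \<open>Labels have characteristic 2, so a vanishing sum means equal labels; the sign
      \<open>s\<close> then turns the second factor into an adjoint.\<close>
    then have "P $ 1 = P $ 2" by (simp add: sum_2)
    define u where "u = P $ 2"
    define s :: complex where "s = of_int (bit_sign (snd u) (fst u))"
    have "s * s = 1"
      by (simp add: s_def flip: of_int_mult)
    have "pauli2 u = cscale s (tensor2 (pauli u) (pauli u))"
      by (simp add: pauli2_def pauli_adjoint vec_eq_iff tensor2_nth flip: s_def)
    then have "tensor2 (pauli u) (pauli u) = cscale s (pauli2 u)"
      using \<open>s * s = 1\<close> by simp
    then have "tensor_family (\<lambda>i. pauli (P $ i)) = cscale s (pauli2 u)"
      by (simp add: tensor_family_2 \<open>P $ 1 = P $ 2\<close> u_def)
    then show ?thesis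
      by (simp add: twirl_cscale tensor_commutant_cscale pauli2)
  next
    case False
    then show ?thesis
      using twirl_paulis_eq_0[OF finite G_mult_pauli False] by (simp add: tensor_commutant_0)
  qed
qed

lemma twirl_tensor3_commutant:
  assumes S: "symplectic_maps (label_action ` G)"
    and ord: "symplectic_maps.ordered_transitive (label_action ` G) commuting_class"
      "symplectic_maps.ordered_transitive (label_action ` G) anticommuting_class"
  shows "twirl G (X :: ((bit^'m)^3) cmat) \<in> tensor_commutant"
proof (rule twirl_commutant_if_paulis)
  interpret symplectic_maps "label_action ` G" by (rule S)
  have orbit: "twirl G (pauli3 q) \<in> tensor_commutant"
    if "(\<Sum>p\<in>C. pauli3 p) \<in> tensor_commutant" "q \<in> C" and
      tr: "\<And>u v u' v'. (u, v) \<in> C \<Longrightarrow> (u', v') \<in> C \<Longrightarrow> \<exists>g\<in>G. label_action g u = u' \<and> label_action g v = v'"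
    for C and q :: "'m label \<times> 'm label"
  proof (rule twirl_orbit_commutant[OF finite G_nonempty G_unitary _ _ that(1,2)])
    show "twirl G (pauli3 p) = twirl G (pauli3 p')" if "p \<in> C" "p' \<in> C" for p p'
    proof -
      obtain u v u' v' where p: "p = (u, v)" "p' = (u', v')" by (metis surj_pair)
      then obtain g where "g \<in> G" "label_action g u = u'" "label_action g v = v'"
        using tr \<open>p \<in> C\<close> \<open>p' \<in> C\<close> by blast
      then show ?thesis using twirl_pauli3_label_action p by metis
    qed
  qed simp
  have ordD: "\<exists>g\<in>G. label_action g u = u' \<and> label_action g v = v'"
    if "ordered_transitive C" "(u, v) \<in> C" "(u', v') \<in> C" for C u v u' v'
    using that unfolding ordered_transitive_def by fast
  have map0: "label_action g 0 = 0" if "g \<in> G" for g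
    using map_0[of "label_action g"] that by blast
  have trans: "\<exists>g\<in>G. label_action g u = v" if "u \<noteq> 0" "v \<noteq> 0" for u v
    using transitive[OF that] by blast
  have pauli3: "twirl G (pauli3 (u, v)) \<in> tensor_commutant" for u v
  proof -
    \<comment> \<open>The degenerate families are orbits by vertex transitivity, because the label
      maps fix 0 and act equally on both entries of \<open>(u, u)\<close>; the last two classes rest
      on ordered transitivity.\<close>
    consider "u = 0" "v = 0" | "u = 0" "v \<noteq> 0" | "u \<noteq> 0" "v = 0" | "u \<noteq> 0" "u = v" |
      "(u, v) \<in> commuting_class" | "(u, v) \<in> anticommuting_class"
      using commutation_sign_cases[of u v] unfolding commuting_class_def anticommuting_class_def by blast
    then show ?thesis
    proof cases
      case 1
      then show ?thesis
        using finite G_nonempty G_unitary by (simp add: twirl_commutant pauli3_0_commutant)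
    next
      case 2
      show ?thesis
      proof (rule orbit[OF sum_pauli3_degenerate(1)[OF refl]])
        fix x y x' y' :: "'m label"
        assume "(x, y) \<in> Pair 0 ` (- {0})" "(x', y') \<in> Pair 0 ` (- {0})"
        then have xy: "x = 0" "x' = 0" "y \<noteq> 0" "y' \<noteq> 0" by blast+
        then show "\<exists>g\<in>G. label_action g x = x' \<and> label_action g y = y'"
          using trans[OF xy(3,4)] map0 by blast
      qed (use 2 in auto)
    next
      case 3
      show ?thesis
      proof (rule orbit[OF sum_pauli3_degenerate(2)[OF refl]])
        fix x y x' y' :: "'m label"
        assume "(x, y) \<in> (\<lambda>u. (u, 0)) ` (- {0})" "(x', y') \<in> (\<lambda>u. (u, 0)) ` (- {0})"
        then have xy: "y = 0" "y' = 0" "x \<noteq> 0" "x' \<noteq> 0" by blast+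
        then show "\<exists>g\<in>G. label_action g x = x' \<and> label_action g y = y'"
          using trans[OF xy(3,4)] map0 by blast
      qed (use 3 in auto)
    next
      case 4
      show ?thesis
      proof (rule orbit[OF sum_pauli3_degenerate(3)[OF refl]])
        fix x y x' y' :: "'m label"
        assume "(x, y) \<in> (\<lambda>u. (u, u)) ` (- {0})" "(x', y') \<in> (\<lambda>u. (u, u)) ` (- {0})"
        then have xy: "y = x" "y' = x'" "x \<noteq> 0" "x' \<noteq> 0" by blast+
        then show "\<exists>g\<in>G. label_action g x = x' \<and> label_action g y = y'"
          using trans[OF xy(3,4)] by blast
      qed (use 4 in auto)
    next
      case 5
      show ?thesis
        by (rule orbit[OF sum_pauli3_commuting 5]) (rule ordD[OF ord(1)])
    next
      case 6
      show ?thesis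
        by (rule orbit[OF sum_pauli3_anticommuting 6]) (rule ordD[OF ord(2)])
    qed
  qed
  fix P :: "('m label)^3"
  show "twirl G (tensor_family (\<lambda>i. pauli (P $ i))) \<in> tensor_commutant"
  proof (cases "(\<Sum>i\<in>UNIV. P $ i) = 0")
    case True
    \<comment> \<open>The third label is forced to be \<open>u + v\<close>, and
      \<open>pauli (u + v)\<close> is the adjoint of \<open>pauli u ** pauli v\<close> up to the
      sign \<open>s\<close>.\<close>
    then have P3: "P $ 3 = P $ 1 + P $ 2" by (simp add: sum_3)
    define u v where "u = P $ 1" and "v = P $ 2"
    define s :: complex where "s = of_int (bit_sign (snd u) (fst v) * bit_sign (snd (u + v)) (fst (u + v)))"
    have "s * s = 1"
      using bit_sign_cases[of "snd u" "fst v"] bit_sign_cases[of "snd (u + v)" "fst (u + v)"]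
      by (auto simp: s_def)
    have "pauli3 (u, v) = cscale s (tensor3 (pauli u) (pauli v) (pauli (u + v)))"
      by (simp add: pauli3_def pauli_mult pauli_adjoint tensor3_cscale s_def)
    then have "tensor3 (pauli u) (pauli v) (pauli (u + v)) = cscale s (pauli3 (u, v))"
      using \<open>s * s = 1\<close> by simp
    then have "tensor_family (\<lambda>i. pauli (P $ i)) = cscale s (pauli3 (u, v))"
      by (simp add: tensor_family_3 P3 u_def v_def)
    then show ?thesis
      by (simp add: twirl_cscale tensor_commutant_cscale pauli3)
  next
    case False
    then show ?thesis
      using twirl_paulis_eq_0[OF finite G_mult_pauli False] by (simp add: tensor_commutant_0)
  qed
qed

end

theorem theorem35:
  fixes G :: "(bit^'m::finite) cmat set" and \<eta> :: "(bit^'m) cmat measure"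
  assumes haar: "is_haar_unitary \<eta>"
    and subgroup: "subgroup G clifford_group"
    and finite: "finite G"
    and paulis: "\<And>a b. pauli_D a b \<in> G"
  shows "(transitive_on G act_vertex hw_vertices \<longrightarrow>
            unitary_design TYPE(2) \<eta> G (\<lambda>_. 1 / real (card G)) (\<lambda>U. U)) \<and>
         (transitive_on G act_vertex hw_vertices \<and> edge_nonedge_transitive G \<and> CARD('m) \<ge> 2 \<longrightarrow>
            unitary_design TYPE(3) \<eta> G (\<lambda>_. 1 / real (card G)) (\<lambda>U. U)) \<and>
         (transitive_on G act_vertex hw_vertices \<and> ordered_edge_nonedge_transitive G \<longrightarrow>
            unitary_design TYPE(3) \<eta> G (\<lambda>_. 1 / real (card G)) (\<lambda>U. U))"
proof (intro conjI impI; (elim conjE)?)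
  note G = subgroup finite paulis
  note design = unitary_design_if_twirl_commutant[OF haar finite G_nonempty[OF G] G_unitary[OF G]]
  assume vertices: "transitive_on G act_vertex hw_vertices"
  note S = symplectic_maps_label_action[OF G vertices]
  show "unitary_design TYPE(2) \<eta> G (\<lambda>_. 1 / real (card G)) (\<lambda>U. U)"
    by (rule design[OF twirl_tensor2_commutant[OF G S]])
  show "unitary_design TYPE(3) \<eta> G (\<lambda>_. 1 / real (card G)) (\<lambda>U. U)"
    if "ordered_edge_nonedge_transitive G"
  proof (rule design[OF twirl_tensor3_commutant[OF G S]])
    show "symplectic_maps.ordered_transitive (label_action ` G) commuting_class"
      using that unfolding ordered_edge_nonedge_transitive_def
      by (intro ordered_transitive_label_action[OF G S, where R = hw_adjacent] adjacent_if_commuting) auto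
    show "symplectic_maps.ordered_transitive (label_action ` G) anticommuting_class"
      using that unfolding ordered_edge_nonedge_transitive_def
      by (intro ordered_transitive_label_action[OF G S, where R = hw_nonadjacent]
          nonadjacent_if_anticommuting) auto
  qed
  show "unitary_design TYPE(3) \<eta> G (\<lambda>_. 1 / real (card G)) (\<lambda>U. U)"
    if edges: "edge_nonedge_transitive G" and m: "CARD('m) \<ge> 2"
  proof -
    have un: "symplectic_maps.unordered_transitive (label_action ` G) commuting_class"
        "symplectic_maps.unordered_transitive (label_action ` G) anticommuting_class"
      using edges unfolding edge_nonedge_transitive_def
      by (intro unordered_transitive_label_action[OF G S, where R = hw_adjacent]
          unordered_transitive_label_action[OF G S, where R = hw_nonadjacent]
          adjacent_if_commuting nonadjacent_if_anticommuting; simp)+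
    \<comment> \<open>Ordered transitivity on either class draws on unordered transitivity on both,
      since the square of an orientation has to be constant on edges and on non-edges.\<close>
    show ?thesis
      by (intro design[OF twirl_tensor3_commutant[OF G S]]
          symplectic_maps.commuting_ordered_transitive[OF S m un]
          symplectic_maps.anticommuting_ordered_transitive[OF S m un])
  qed
qed

end
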